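(* Let $\mathbb{F}_{p^k}\subseteq\mathbb{F}_q$ be finite fields of characteristic $p$ with $q$ fixed, and let $n\to\infty$. Let $\overline{\mathcal{R}}=(\mathcal{R}_0,\dots,\mathcal{R}_{n-1})$ be an ordered collection of subsets $\mathcal{R}_i\subset\mathbb{F}_{p^k}$, each of size $s$, such that for every $i$ the set $\mathbb{F}_{p^k}\setminus\mathcal{R}_i$ is not contained in a proper affine subspace of $\mathbb{F}_{p^k}$. The number of squarefree, monic polynomials in $\mathbb{F}_q[t]$ of degree $n$ in which, for each $0\le i\le n-1$, the coefficient of $t^i$ lies in $\mathbb{F}_{p^k}\setminus\mathcal{R}_i$ is \[\kappa_{\overline{\mathcal{R}}}\,(p^k-s)^n\left(1+O_q\bigl(p^{-kn^{1/4}}\bigr)\right),\] where \[\kappa_{\overline{\mathcal{R}}}=\begin{cases}\dfrac1{1+1/p^k}&\text{if }0\in\mathcal{R}_0\text{ or }0\in\mathcal{R}_1,\\[2mm] \dfrac1{1+1/p^k}\cdot\Bigl(1-\dfrac1{(p^k-s)^2}\Bigr)&\text{if }0\notin\mathcal{R}_0\text{ and }0\notin\mathcal{R}_1.\end{cases}\]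
   Context: Affine subspaces of $\mathbb{F}_{p^k}$ are translates of $\mathbb{F}_p$-linear subspaces, with $\mathbb{F}_{p^k}$ viewed as a vector space over the prime field $\mathbb{F}_p$; proper means different from all of $\mathbb{F}_{p^k}$ (so single points count as affine subspaces of dimension $0$). $O_q(\cdot)$ means that the implied constant depends only on $q$. *)

theory Defs
  imports Complex_Main "HOL-Computational_Algebra.Computational_Algebra"
begin

definition is_subfield :: "'a :: field set \<Rightarrow> bool" where
  "is_subfield K \<longleftrightarrow>
     0 \<in> K \<and> 1 \<in> K \<and>
     (\<forall>x\<in>K. \<forall>y\<in>K. x + y \<in> K \<and> x * y \<in> K) \<and>
     (\<forall>x\<in>K. - x \<in> K \<and> inverse x \<in> K)"

(* In positive characteristic p the image of the integers is the prime field F_p. *)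
definition prime_subfield :: "'a :: finite_field set" where
  "prime_subfield = range of_int"

definition Fp_subspace :: "'a :: finite_field set \<Rightarrow> bool" where
  "Fp_subspace V \<longleftrightarrow>
     0 \<in> V \<and> (\<forall>x\<in>V. \<forall>y\<in>V. x + y \<in> V) \<and>
     (\<forall>c\<in>prime_subfield. \<forall>x\<in>V. c * x \<in> V)"

definition affine_subspace_of :: "'a :: finite_field set \<Rightarrow> 'a set \<Rightarrow> bool" where
  "affine_subspace_of K A \<longleftrightarrow>
     (\<exists>a\<in>K. \<exists>V. V \<subseteq> K \<and> Fp_subspace V \<and> A = (+) a ` V)"

definition proper_affine_subspace_of :: "'a :: finite_field set \<Rightarrow> 'a set \<Rightarrow> bool" where
  "proper_affine_subspace_of K A \<longleftrightarrow> affine_subspace_of K A \<and> A \<noteq> K"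

(* A collection (R 0, ..., R (n - 1)) is given by a function on nat of which only the
   values at i < n matter. *)
definition restricted_squarefree ::
    "'a :: finite_field set \<Rightarrow> (nat \<Rightarrow> 'a set) \<Rightarrow> nat \<Rightarrow> 'a poly set" where
  "restricted_squarefree K R n =
     {f. degree f = n \<and> lead_coeff f = 1 \<and> squarefree f \<and> (\<forall>i<n. coeff f i \<in> K - R i)}"

definition kappa :: "nat \<Rightarrow> nat \<Rightarrow> nat \<Rightarrow> (nat \<Rightarrow> 'a :: finite_field set) \<Rightarrow> real" where
  "kappa p k s R =
     (if 0 \<in> R 0 \<or> 0 \<in> R 1
      then 1 / (1 + 1 / real p ^ k)
      else 1 / (1 + 1 / real p ^ k) * (1 - 1 / (real p ^ k - real s)\<^sup>2))"

end

theory Submission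
  imports Defs "HOL-Library.FuncSet" "HOL-Number_Theory.Cong" "HOL-Real_Asymp.Real_Asymp"
begin

text \<open>
  Let \<open>F\<close> be the ambient finite field, \<open>K\<close> the subfield with \<open>Q = p^k\<close> elements, \<open>D\<^sub>i = K - R\<^sub>i\<close> the
  allowed coefficient sets and \<open>d = Q - s\<close> their common size; the hypothesis on affine subspaces
  forces \<open>d \<ge> 2\<close>.  The monic polynomials \<open>f\<close> under consideration form a product set with \<open>d^n\<close>
  elements.  A polynomial \<open>f\<close> over \<open>K\<close> is squarefree over \<open>F\<close> iff no \<open>\<pi>\<^sup>2\<close> with \<open>\<pi>\<close> monic and
  irreducible over \<open>K\<close> divides it (\<open>squarefree_iff_Kirr\<close>), so everything happens over \<open>K\<close>.  The
  irreducibles are treated in three classes, separated by a bound \<open>m\<close> of the order of \<open>n^(1/4)\<close>.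

  \<^emph>\<open>Small irreducibles other than \<open>t\<close>.\<close>  Let \<open>g\<close> be monic over \<open>K\<close> with \<open>g(0) \<noteq> 0\<close>.  Expand the
  indicator of \<open>g dvd f\<close> into characters of the residue ring of \<open>g\<close>.  A nontrivial character
  restricts to the coefficient of \<open>t^i\<close> as \<open>a \<mapsto> \<psi>(a c\<^sub>i)\<close>, where the \<open>c\<^sub>i\<close> satisfy a linear recurrence
  with characteristic polynomial \<open>g\<close>, hence cannot vanish \<open>degree g\<close> times in a row.  Since \<open>D\<^sub>i\<close> is not
  contained in a proper affine subspace, \<open>a \<mapsto> \<psi>(a c)\<close> is not constant on it for \<open>c \<noteq> 0\<close>, so each
  nonzero \<open>c\<^sub>i\<close> contributes a factor of at most some \<open>\<rho> < 1\<close>, which may be chosen depending on \<open>F\<close> only.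
  The proportion of \<open>f\<close> divisible by \<open>g\<close> is therefore \<open>Q^(- degree g)\<close> up to \<open>\<rho>^(n div degree g)\<close>
  (\<open>equidistribution\<close>).  This is useful only as long as \<open>degree g\<close> is much smaller than \<open>n\<close>, so the
  inclusion-exclusion over products of distinct irreducibles must be cut off at total degree \<open>m\<close>.  The cost
  of the cut is at most the number of square divisors \<open>b\<^sup>2\<close> with \<open>m < degree b \<le> 2 m\<close>
  (\<open>truncated_sieve\<close>), about \<open>Q^(- m)\<close> on average.  The Moebius sums in the main term are
  computed exactly and give the density \<open>Q / (Q + 1)\<close> (\<open>small_irreducibles_sieve\<close>).

  \<^emph>\<open>Large irreducibles.\<close>  If \<open>\<pi>\<^sup>2\<close> divides \<open>f\<close> then \<open>\<pi>\<close> divides \<open>f\<close> and \<open>f'\<close>.  The derivative does not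
  involve the coefficients of \<open>t^(p i)\<close>.  With all the others fixed, and \<open>f' \<noteq> 0\<close>, at most \<open>n\<close>
  irreducibles can occur, and each of them leaves at most one choice for the coefficients of
  \<open>t^0, t^p, \<dots>, t^(p m)\<close> when \<open>degree \<pi> > m\<close>.  So a large \<open>\<pi>\<close> occurs for a proportion of at most
  \<open>(n + 1) d^(- (m + 1))\<close> of all \<open>f\<close> (\<open>large_irreducibles_bound\<close>).

  \<^emph>\<open>The irreducible \<open>t\<close>.\<close>  Here \<open>t\<^sup>2\<close> divides \<open>f\<close> iff the two lowest coefficients vanish.  If this is
  permitted, those \<open>f\<close> form a product set with \<open>d^(n - 2)\<close> elements to which the sieve applies in the
  same way; subtracting them produces the factor \<open>1 - 1 / d\<^sup>2\<close>.

  With \<open>m = 2 q \<lceil>n^(1/4)\<rceil>\<close> and \<open>q\<close> the size of \<open>F\<close>, all errors are \<open>O(q^(- n^(1/4)))\<close>.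
\<close>

section \<open>Polynomials over the subfield\<close>

lemma comaximal_power:
  fixes a b :: "'b :: comm_ring_1"
  assumes "x * a + y * b = 1"
  obtains X Y where "X * a ^ m + Y * b ^ n = 1"
proof -
  have mult: "\<exists>X Y. X * a + Y * (b * c) = 1"
    if "x * a + y * b = 1" "u * a + v * c = 1" for a b c x y u v :: 'b
  proof -
    have "(x * a + y * b) * (u * a + v * c) = 1"
      using that by simp
    then have "(x * a * u + x * v * c + y * b * u) * a + (y * v) * (b * c) = 1"
      by (simp add: algebra_simps)
    then show ?thesis by blast
  qed
  have power: "\<exists>X Y. X * a + Y * b ^ n = 1" if "x * a + y * b = 1" for a b x y :: 'b and n
  proof (induction n)
    case 0
    then show ?case
      by (intro exI[of _ 0] exI[of _ 1]) simp
  next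
    case (Suc n)
    then show ?case
      using mult[OF that] by auto
  qed
  obtain X Y where "X * a + Y * b ^ n = 1"
    using power[OF assms] by blast
  then have "Y * b ^ n + X * a = 1"
    by (simp add: add.commute)
  then obtain U V where "U * b ^ n + V * a ^ m = 1"
    using power by blast
  then show ?thesis
    using that[of V U] by (simp add: add.commute)
qed

lemma degree_pderiv_le: "degree (pderiv f) \<le> degree f - 1"
  by (rule degree_le) (auto simp: coeff_pderiv coeff_eq_0)

lemma degree_pderiv_less: "degree f \<ge> 1 \<Longrightarrow> degree (pderiv f) < degree f"
  using degree_pderiv_le[of f] by linarith

locale finite_subfield =
  fixes K :: "'a :: finite_field set"
  assumes subfield: "is_subfield K"
begin

lemma K_closed [simp, intro]:
  "0 \<in> K" "1 \<in> K"
  "x \<in> K \<Longrightarrow> y \<in> K \<Longrightarrow> x + y \<in> K"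
  "x \<in> K \<Longrightarrow> y \<in> K \<Longrightarrow> x * y \<in> K"
  "x \<in> K \<Longrightarrow> - x \<in> K"
  "x \<in> K \<Longrightarrow> inverse x \<in> K"
  using subfield unfolding is_subfield_def by blast+

lemma K_diff [simp, intro]: "x \<in> K \<Longrightarrow> y \<in> K \<Longrightarrow> x - y \<in> K"
  using K_closed(3)[of x "- y"] by simp

lemma K_divide [simp, intro]: "x \<in> K \<Longrightarrow> y \<in> K \<Longrightarrow> x / y \<in> K"
  by (simp add: divide_inverse)

lemma K_sum [intro]: "(\<And>i. i \<in> I \<Longrightarrow> f i \<in> K) \<Longrightarrow> sum f I \<in> K"
  by (induction I rule: infinite_finite_induct) auto

lemma K_power [intro]: "x \<in> K \<Longrightarrow> x ^ n \<in> K"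
  by (induction n) auto

lemma K_of_nat [simp, intro]: "of_nat n \<in> K"
  by (induction n) auto

lemma card_K_ge_2: "card K \<ge> 2"
proof -
  have "card {0, 1 :: 'a} \<le> card K"
    by (intro card_mono) auto
  then show ?thesis by simp
qed

lemma frobenius_bij_betw: "bij_betw (\<lambda>x. x ^ CHAR('a)) K K"
proof -
  have "inj_on (\<lambda>x. x ^ CHAR('a)) K"
  proof (rule inj_onI)
    fix x y :: 'a
    assume "x ^ CHAR('a) = y ^ CHAR('a)"
    moreover have "x ^ CHAR('a) = (x - y) ^ CHAR('a) + y ^ CHAR('a)"
      using freshmans_dream[of "CHAR('a)" "x - y" y] by simp
    ultimately show "x = y"
      by simp
  qed
  then show ?thesis
    by (simp add: bij_betw_def endo_inj_surj K_power image_subset_iff)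
qed

text \<open>
  Polynomials over \<open>K\<close> form a subset of the polynomials over the big field, rather than a type of
  their own, so that degrees, derivatives, divisibility and squarefreeness keep their library
  meaning.  Irreducibility is the only notion that depends on the field.
\<close>
definition KX :: "'a poly set" where
  "KX = {f. \<forall>i. coeff f i \<in> K}"

definition Kmonic :: "'a poly set" where
  "Kmonic = {f \<in> KX. lead_coeff f = 1}"

definition Kirr :: "'a poly set" where
  "Kirr = {\<pi> \<in> Kmonic. \<pi> \<noteq> 1 \<and> (\<forall>g\<in>Kmonic. g dvd \<pi> \<longrightarrow> g = 1 \<or> g = \<pi>)}"

lemma KX_closed [simp, intro]:
  "0 \<in> KX" "1 \<in> KX"
  "f \<in> KX \<Longrightarrow> g \<in> KX \<Longrightarrow> f + g \<in> KX"
  "f \<in> KX \<Longrightarrow> g \<in> KX \<Longrightarrow> f - g \<in> KX"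
  "f \<in> KX \<Longrightarrow> - f \<in> KX"
  "c \<in> K \<Longrightarrow> f \<in> KX \<Longrightarrow> smult c f \<in> KX"
  "c \<in> K \<Longrightarrow> monom c n \<in> KX"
  by (auto simp: KX_def coeff_1)

lemma KX_mult [simp, intro]: "f \<in> KX \<Longrightarrow> g \<in> KX \<Longrightarrow> f * g \<in> KX"
  by (auto simp: KX_def coeff_mult)

lemma KX_sum [intro]: "(\<And>i. i \<in> I \<Longrightarrow> f i \<in> KX) \<Longrightarrow> sum f I \<in> KX"
  by (induction I rule: infinite_finite_induct) auto

lemma KX_pderiv [intro]: "f \<in> KX \<Longrightarrow> pderiv f \<in> KX"
  by (auto simp: KX_def coeff_pderiv simp del: of_nat_Suc)

text \<open>
  Long division of polynomials over \<open>K\<close> stays over \<open>K\<close>, and quotient and remainder are unique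
  over the big field.
\<close>
lemma KX_division:
  assumes "f \<in> KX" "g \<in> KX" "g \<noteq> 0"
  shows "f div g \<in> KX \<and> f mod g \<in> KX"
  using assms(1)
proof (induction "length (coeffs f)" arbitrary: f rule: less_induct)
  case less
  show ?case
  proof (cases "f = 0 \<or> degree f < degree g")
    case True
    then show ?thesis
      using less.prems by (auto simp: div_poly_less mod_poly_less)
  next
    case False
    define u where "u = monom (lead_coeff f / lead_coeff g) (degree f - degree g)"
    define f' where "f' = f - u * g"
    have lc: "lead_coeff f \<in> K" "lead_coeff g \<in> K"
      using less.prems assms(2) by (auto simp: KX_def)
    have u: "u \<in> KX"
      unfolding u_def using lc by auto
    have f': "f' \<in> KX"
      unfolding f'_def using u less.prems assms(2) by auto
    have "f' = 0 \<or> degree f' < degree f"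
    proof -
      have "coeff f' (degree f) = 0"
        using False assms(3) by (simp add: f'_def u_def coeff_monom_mult)
      moreover have "degree f' \<le> degree f"
        unfolding f'_def u_def
        by (rule degree_diff_le) (use False in \<open>auto intro!: order.trans[OF degree_mult_le] 
              order.trans[OF add_mono[OF degree_monom_le order.refl]]\<close>)
      ultimately show ?thesis
        by (metis leading_coeff_0_iff le_neq_implies_less)
    qed
    then have "length (coeffs f') < length (coeffs f)"
      using False by (cases "f' = 0") (auto simp: length_coeffs_degree)
    from less.hyps[OF this f'] have IH: "f' div g \<in> KX" "f' mod g \<in> KX"
      by auto
    have f: "f = u * g + f'"
      by (simp add: f'_def)
    have "f div g = u + f' div g" "f mod g = f' mod g"
      unfolding f using assms(3) by simp_all
    then show ?thesis
      using IH u by auto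
  qed
qed

lemma KmonicD:
  assumes "f \<in> Kmonic"
  shows "f \<in> KX" "lead_coeff f = 1" "f \<noteq> 0"
  using assms by (auto simp: Kmonic_def)

lemma one_Kmonic [simp, intro]: "1 \<in> Kmonic"
  by (auto simp: Kmonic_def)

lemma Kmonic_mult [intro]: "f \<in> Kmonic \<Longrightarrow> g \<in> Kmonic \<Longrightarrow> f * g \<in> Kmonic"
  by (auto simp: Kmonic_def lead_coeff_mult)

lemma Kmonic_prod [intro]: "(\<And>i. i \<in> I \<Longrightarrow> f i \<in> Kmonic) \<Longrightarrow> prod f I \<in> Kmonic"
  by (induction I rule: infinite_finite_induct) auto

lemma Kmonic_degree_0: "f \<in> Kmonic \<Longrightarrow> degree f = 0 \<longleftrightarrow> f = 1"
  using KmonicD(2)[of f] by (auto elim: degree_eq_zeroE)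

lemma Kmonic_cofactor:
  assumes "f * g \<in> Kmonic" "f \<in> Kmonic"
  shows "g \<in> Kmonic"
proof -
  have "f * g div f \<in> KX"
    using KX_division[of "f * g" f] assms KmonicD by blast
  then have "g \<in> KX"
    using KmonicD(3)[OF assms(2)] by simp
  moreover have "lead_coeff g = 1"
    using KmonicD(2)[OF assms(1)] KmonicD(2)[OF assms(2)] by (simp only: lead_coeff_mult) simp
  ultimately show ?thesis
    by (simp add: Kmonic_def)
qed

lemma Kmonic_dvd_degree_eq:
  assumes "f \<in> Kmonic" "g \<in> Kmonic" "f dvd g" "degree f = degree g"
  shows "f = g"
proof -
  obtain h where h: "g = f * h"
    using assms(3) by auto
  have hm: "h \<in> Kmonic"
    using Kmonic_cofactor assms h by blast
  then have "degree h = 0"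
    using assms(4) KmonicD(3)[OF hm] KmonicD(3)[OF assms(1)] by (simp add: h degree_mult_eq)
  then show ?thesis
    using Kmonic_degree_0[OF hm] h by simp
qed

text \<open>
  A nonzero combination of \<open>a\<close> and \<open>b\<close> of least degree divides both, because the remainders of
  the divisions are again combinations.
\<close>
lemma Kmonic_bezout:
  assumes "a \<in> KX" "b \<in> KX" "a \<noteq> 0"
  obtains g x y where "g \<in> Kmonic" "g dvd a" "g dvd b" "x \<in> KX" "y \<in> KX" "g = x * a + y * b"
proof -
  define I where "I = {x * a + y * b | x y. x \<in> KX \<and> y \<in> KX}"
  have I_KX: "I \<subseteq> KX"
    using assms by (auto simp: I_def)
  have aI: "a \<in> I"
    unfolding I_def by (rule CollectI, rule exI[of _ 1], rule exI[of _ 0]) auto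
  have bI: "b \<in> I"
    unfolding I_def by (rule CollectI, rule exI[of _ 0], rule exI[of _ 1]) auto
  obtain g0 where g0: "g0 \<in> I" "g0 \<noteq> 0" and min: "\<And>h. h \<in> I \<Longrightarrow> h \<noteq> 0 \<Longrightarrow> degree g0 \<le> degree h"
    using ex_has_least_nat[of "\<lambda>h. h \<in> I \<and> h \<noteq> 0" a degree] aI assms(3) by auto
  have g0K: "g0 \<in> KX"
    using g0 I_KX by auto
  have dvd: "g0 dvd h" if h: "h \<in> I" for h
  proof -
    obtain x y where xy: "g0 = x * a + y * b" "x \<in> KX" "y \<in> KX"
      using g0(1) by (auto simp: I_def)
    obtain u v where uv: "h = u * a + v * b" "u \<in> KX" "v \<in> KX"
      using h by (auto simp: I_def)
    define w where "w = h div g0"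
    have w: "w \<in> KX"
      using KX_division[of h g0] h g0 I_KX unfolding w_def by blast
    have "h mod g0 = h - w * g0"
      by (simp add: w_def minus_div_mult_eq_mod)
    also have "\<dots> = (u - w * x) * a + (v - w * y) * b"
      by (simp add: uv xy algebra_simps)
    finally have "h mod g0 \<in> I"
      unfolding I_def using uv xy w by blast
    then have "h mod g0 = 0"
      using min[of "h mod g0"] degree_mod_less[of g0 h] g0(2) by fastforce
    then show ?thesis by auto
  qed
  obtain x y where xy: "g0 = x * a + y * b" "x \<in> KX" "y \<in> KX"
    using g0(1) by (auto simp: I_def)
  define c where "c = inverse (lead_coeff g0)"
  have c: "c \<in> K" "c \<noteq> 0"
    using g0K g0(2) by (auto simp: c_def KX_def)
  show ?thesis
  proof (rule that)
    show "smult c g0 \<in> Kmonic"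
      using g0K g0(2) c by (auto simp: Kmonic_def c_def)
    show "smult c g0 dvd a" "smult c g0 dvd b"
      using dvd[OF aI] dvd[OF bI] c by (auto simp: smult_dvd)
    show "smult c g0 = smult c x * a + smult c y * b"
      by (simp add: xy smult_add_right)
  qed (use c xy in auto)
qed

lemma KirrD:
  assumes "\<pi> \<in> Kirr"
  shows "\<pi> \<in> Kmonic" "\<pi> \<in> KX" "\<pi> \<noteq> 0" "\<pi> \<noteq> 1" "degree \<pi> \<ge> 1" "\<not> \<pi> dvd 1"
proof -
  show *: "\<pi> \<in> Kmonic" "\<pi> \<noteq> 1"
    using assms by (auto simp: Kirr_def)
  then show "\<pi> \<in> KX" "\<pi> \<noteq> 0"
    using KmonicD by auto
  have "degree \<pi> \<noteq> 0"
    using Kmonic_degree_0 * by auto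
  then show "degree \<pi> \<ge> 1" by simp
  then show "\<not> \<pi> dvd 1"
    using is_unit_iff_degree[OF \<open>\<pi> \<noteq> 0\<close>] by simp
qed

lemma Kirr_bezout:
  assumes "\<pi> \<in> Kirr" "u \<in> KX" "\<not> \<pi> dvd u"
  obtains x y where "x \<in> KX" "y \<in> KX" "x * \<pi> + y * u = 1"
proof -
  obtain g x y where g: "g \<in> Kmonic" "g dvd \<pi>" "g dvd u" "x \<in> KX" "y \<in> KX" "g = x * \<pi> + y * u"
    using Kmonic_bezout[of \<pi> u] assms KirrD by metis
  then have "g = 1"
    using assms by (auto simp: Kirr_def)
  then show ?thesis
    using g that by metis
qed

lemma Kirr_dvd_mult:
  assumes "\<pi> \<in> Kirr" "u \<in> KX" "\<pi> dvd u * v"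
  shows "\<pi> dvd u \<or> \<pi> dvd v"
proof (rule disjCI)
  assume "\<not> \<pi> dvd v"
  show "\<pi> dvd u"
  proof (rule ccontr)
    assume "\<not> \<pi> dvd u"
    then obtain x y where xy: "x * \<pi> + y * u = 1"
      using Kirr_bezout assms by metis
    have "v = (x * \<pi> + y * u) * v"
      by (simp add: xy)
    also have "\<dots> = \<pi> * (x * v) + (u * v) * y"
      by (simp add: algebra_simps)
    finally have "\<pi> dvd v"
      using assms(3) by (metis dvd_add dvd_mult2 dvd_triv_left)
    with \<open>\<not> \<pi> dvd v\<close> show False by simp
  qed
qed

lemma Kirr_dvd_power:
  assumes "\<pi> \<in> Kirr" "u \<in> KX" "\<pi> dvd u ^ n"
  shows "\<pi> dvd u"
  using assms(3)
proof (induction n)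
  case 0
  then show ?case
    using KirrD(6)[OF assms(1)] by simp
next
  case (Suc n)
  then show ?case
    using Kirr_dvd_mult[OF assms(1,2), of "u ^ n"] by auto
qed

lemma Kirr_dvd_Kirr:
  assumes "\<pi> \<in> Kirr" "\<sigma> \<in> Kirr" "\<pi> dvd \<sigma>"
  shows "\<pi> = \<sigma>"
  using assms KirrD(1,4)[OF assms(1)] unfolding Kirr_def by blast

lemma Kirr_dvd_prod:
  assumes "\<pi> \<in> Kirr" "A \<subseteq> Kirr" "finite A" "\<pi> dvd \<Prod>A"
  shows "\<pi> \<in> A"
  using assms(3,2,4)
proof (induction A rule: finite_induct)
  case empty
  then show ?case
    using KirrD(6)[OF assms(1)] by simp
next
  case (insert \<sigma> A)
  then have "\<pi> dvd \<sigma> \<or> \<pi> dvd \<Prod>A"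
    by (intro Kirr_dvd_mult[OF assms(1)]) (auto simp: KirrD)
  then show ?case
    using insert Kirr_dvd_Kirr[OF assms(1), of \<sigma>] by auto
qed

lemma Kmonic_Prod: "A \<subseteq> Kirr \<Longrightarrow> \<Prod>A \<in> Kmonic"
  by (rule Kmonic_prod) (auto simp: KirrD)

text \<open>
  Distinct irreducibles are coprime, so for sets of irreducibles simultaneous divisibility
  is divisibility by the product; \<open>n = 1\<close> and \<open>n = 2\<close> are the relevant exponents.
\<close>
lemma Prod_power_dvd_iff:
  assumes "A \<subseteq> Kirr" "finite A"
  shows "(\<Prod>A) ^ n dvd f \<longleftrightarrow> (\<forall>\<pi>\<in>A. \<pi> ^ n dvd f)"
  using assms(2,1)
proof (induction A rule: finite_induct)
  case empty
  then show ?case by simp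
next
  case (insert \<sigma> A)
  have \<sigma>: "\<sigma> \<in> Kirr" and A: "A \<subseteq> Kirr"
    using insert.prems by auto
  have "\<not> \<sigma> dvd \<Prod>A"
    using Kirr_dvd_prod[OF \<sigma> A] insert.hyps by auto
  then obtain x y where xy: "x * \<sigma> + y * \<Prod>A = 1"
    using Kirr_bezout[OF \<sigma>, of "\<Prod>A"] Kmonic_Prod[OF A] KmonicD(1) by metis
  then obtain X Y where XY: "X * \<sigma> ^ n + Y * \<Prod>A ^ n = 1"
    using comaximal_power by metis
  have "\<sigma> ^ n * \<Prod>A ^ n dvd f" if "\<sigma> ^ n dvd f" "\<Prod>A ^ n dvd f"
  proof -
    have "f = f * (X * \<sigma> ^ n + Y * \<Prod>A ^ n)"
      using XY by simp
    also have "\<dots> = X * (\<sigma> ^ n * f) + Y * (f * \<Prod>A ^ n)"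
      by (simp add: algebra_simps)
    finally show ?thesis
      using that by (metis dvd_add dvd_mult dvd_refl mult_dvd_mono)
  qed
  then have "(\<sigma> * \<Prod>A) ^ n dvd f \<longleftrightarrow> \<sigma> ^ n dvd f \<and> \<Prod>A ^ n dvd f"
    by (auto simp: power_mult_distrib dest: dvd_mult_left dvd_mult_right)
  then show ?case
    using insert A by simp
qed

lemma ex_Kirr_dvd:
  assumes "f \<in> Kmonic" "f \<noteq> 1"
  obtains \<pi> where "\<pi> \<in> Kirr" "\<pi> dvd f"
proof -
  obtain \<pi> where \<pi>: "\<pi> \<in> Kmonic" "\<pi> \<noteq> 1" "\<pi> dvd f"
    and min: "\<And>h. h \<in> Kmonic \<Longrightarrow> h \<noteq> 1 \<Longrightarrow> h dvd f \<Longrightarrow> degree \<pi> \<le> degree h"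
    using ex_has_least_nat[of "\<lambda>h. h \<in> Kmonic \<and> h \<noteq> 1 \<and> h dvd f" f degree] assms by auto
  have "\<pi> \<in> Kirr"
    unfolding Kirr_def
  proof (intro CollectI conjI ballI impI)
    fix g assume g: "g \<in> Kmonic" "g dvd \<pi>"
    show "g = 1 \<or> g = \<pi>"
    proof (cases "g = 1")
      case False
      then have "degree \<pi> \<le> degree g"
        using min g \<pi> dvd_trans by blast
      moreover have "degree g \<le> degree \<pi>"
        using g \<pi> KmonicD(3) by (intro dvd_imp_degree_le) auto
      ultimately show ?thesis
        using Kmonic_dvd_degree_eq g \<pi> by auto
    qed auto
  qed (use \<pi> in auto)
  with \<pi> that show ?thesis by blast
qed

text \<open>
  Frobenius is bijective on the finite field \<open>K\<close> and additive in characteristic \<open>p\<close>, so a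
  polynomial in \<open>t^p\<close> is a \<open>p\<close>-th power.
\<close>
lemma KX_pth_root:
  assumes "\<And>i. i \<le> m \<Longrightarrow> c i \<in> K"
  obtains u where "u \<in> KX" "degree u \<le> m"
    "u ^ CHAR('a) = (\<Sum>i\<le>m. monom (c i) (CHAR('a) * i))"
proof -
  define p where "p = CHAR('a)"
  define \<phi> where "\<phi> = inv_into K (\<lambda>x. x ^ p)"
  have \<phi>: "\<phi> x \<in> K" "\<phi> x ^ p = x" if "x \<in> K" for x
  proof -
    have "x \<in> (\<lambda>x. x ^ p) ` K"
      using bij_betw_imp_surj_on[OF frobenius_bij_betw] that by (simp add: p_def)
    then show "\<phi> x \<in> K" "\<phi> x ^ p = x"
      unfolding \<phi>_def by (rule inv_into_into, rule f_inv_into_f)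
  qed
  define u where "u = (\<Sum>i\<le>m. monom (\<phi> (c i)) i)"
  have "u ^ p = (\<Sum>i\<le>m. monom (\<phi> (c i)) i ^ p)"
    unfolding u_def by (intro freshmans_dream_sum) (auto simp: p_def)
  also have "\<dots> = (\<Sum>i\<le>m. monom (c i) (p * i))"
    using \<phi> assms by (simp add: monom_power mult.commute)
  finally have "u ^ p = (\<Sum>i\<le>m. monom (c i) (p * i))" .
  moreover have "u \<in> KX"
    unfolding u_def using \<phi> assms by auto
  moreover have "degree u \<le> m"
    unfolding u_def by (intro degree_sum_le) (auto intro: order.trans[OF degree_monom_le])
  ultimately show ?thesis
    using that unfolding p_def by blast
qed

text \<open>
  A polynomial with vanishing derivative is a polynomial in \<open>t^p\<close>, hence a \<open>p\<close>-th power, hence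
  reducible.
\<close>
lemma Kirr_pderiv_nonzero:
  assumes "\<pi> \<in> Kirr"
  shows "pderiv \<pi> \<noteq> 0"
proof
  assume 0: "pderiv \<pi> = 0"
  define p where "p = CHAR('a)"
  have p: "prime p"
    by (simp add: p_def)
  then have p0: "p > 0"
    using prime_gt_0_nat by blast
  have c0: "coeff \<pi> i = 0" if "\<not> p dvd i" for i
  proof -
    have "i > 0"
      using that by (cases i) auto
    then obtain j where j: "i = Suc j"
      by (cases i) auto
    have "of_nat i * coeff \<pi> i = 0"
      using arg_cong[OF 0, of "\<lambda>f. coeff f j"] by (simp add: coeff_pderiv j)
    moreover have "(of_nat i :: 'a) \<noteq> 0"
      using that by (simp add: of_nat_eq_0_iff_char_dvd p_def)
    ultimately show ?thesis by simp
  qed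
  define N where "N = degree \<pi> div p"
  have "coeff \<pi> i \<in> K" for i
    using KirrD(2)[OF assms] by (auto simp: KX_def)
  then obtain u where u: "u \<in> KX" "u ^ p = (\<Sum>i\<le>N. monom (coeff \<pi> (p * i)) (p * i))"
    using KX_pth_root[of N "\<lambda>i. coeff \<pi> (p * i)"] unfolding p_def by metis
  note u(2)
  also have "\<dots> = \<pi>"
  proof (rule poly_eqI)
    fix j
    have "coeff (\<Sum>i\<le>N. monom (coeff \<pi> (p * i)) (p * i)) j =
        (\<Sum>i\<le>N. if p * i = j then coeff \<pi> j else 0)"
      by (auto simp: coeff_sum intro!: sum.cong)
    also have "\<dots> = coeff \<pi> j"
    proof (cases "p dvd j \<and> j div p \<le> N")
      case True
      then have "(p * i = j) = (i = j div p)" for i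
        using p0 by auto
      then show ?thesis
        using True by simp
    next
      case False
      then have "coeff \<pi> j = 0"
        using c0[of j] div_le_mono[of j "degree \<pi>" p] unfolding N_def
        by (metis coeff_eq_0 not_le_imp_less)
      then show ?thesis
        by (intro trans[OF sum.neutral]) auto
    qed
    finally show "coeff (\<Sum>i\<le>N. monom (coeff \<pi> (p * i)) (p * i)) j = coeff \<pi> j" .
  qed
  finally have up: "u ^ p = \<pi>" .
  then have "\<pi> dvd u"
    using Kirr_dvd_power[OF assms u(1), of p] by simp
  moreover have "u \<noteq> 0"
    using up KirrD(3)[OF assms] p0 by auto
  ultimately have "degree \<pi> \<le> degree u"
    by (rule dvd_imp_degree_le)
  moreover have "degree \<pi> = p * degree u"
    by (simp flip: up add: degree_power_eq \<open>u \<noteq> 0\<close>)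
  moreover have "degree u \<ge> 1"
    using calculation(2) KirrD(5)[OF assms] by (cases "degree u") auto
  moreover have "p \<ge> 2"
    using p prime_ge_2_nat by blast
  ultimately have "2 * degree u \<le> degree u"
    by (metis mult_le_mono1 le_trans)
  then show False
    using \<open>degree u \<ge> 1\<close> by simp
qed

text \<open>
  If \<open>f = \<pi> g\<close> then \<open>\<pi>\<close> divides \<open>f' - \<pi> g' = \<pi>' g\<close>, and for degree reasons it does not divide
  \<open>\<pi>' \<noteq> 0\<close>.
\<close>
lemma Kirr_square_dvd:
  assumes "\<pi> \<in> Kirr" "\<pi> dvd f" "\<pi> dvd pderiv f"
  shows "\<pi> ^ 2 dvd f"
proof -
  obtain g where g: "f = \<pi> * g"
    using assms(2) by auto
  have "\<pi> dvd pderiv \<pi> * g"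
    using assms(3) unfolding g pderiv_mult
    by (metis dvd_add_right_iff dvd_triv_left mult.commute)
  moreover have "\<not> \<pi> dvd pderiv \<pi>"
  proof
    assume "\<pi> dvd pderiv \<pi>"
    then have "degree \<pi> \<le> degree (pderiv \<pi>)"
      using Kirr_pderiv_nonzero[OF assms(1)] by (intro dvd_imp_degree_le)
    then show False
      using degree_pderiv_less[OF KirrD(5)[OF assms(1)]] by simp
  qed
  ultimately have "\<pi> dvd g"
    using Kirr_dvd_mult[OF assms(1) KX_pderiv[OF KirrD(2)[OF assms(1)]]] by blast
  then show ?thesis
    by (simp add: g power2_eq_square)
qed

text \<open>
  Squarefreeness over the big field can be tested with irreducibles over the small field,
  because it only depends on \<open>f\<close> and \<open>f'\<close> having a common factor, and the Euclidean
  algorithm finds one over the field of the coefficients.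
\<close>
lemma squarefree_iff_Kirr:
  assumes f: "f \<in> Kmonic"
  shows "squarefree f \<longleftrightarrow> (\<forall>\<pi>\<in>Kirr. \<not> \<pi> ^ 2 dvd f)"
proof
  assume "squarefree f"
  then show "\<forall>\<pi>\<in>Kirr. \<not> \<pi> ^ 2 dvd f"
    using KirrD(6) by (auto simp: squarefree_def)
next
  assume no: "\<forall>\<pi>\<in>Kirr. \<not> \<pi> ^ 2 dvd f"
  obtain g x y where g: "g \<in> Kmonic" "g dvd f" "g dvd pderiv f" "g = x * f + y * pderiv f"
    using Kmonic_bezout[of f "pderiv f"] f KmonicD KX_pderiv by metis
  have "g = 1"
  proof (rule ccontr)
    assume "g \<noteq> 1"
    then obtain \<pi> where "\<pi> \<in> Kirr" "\<pi> dvd g"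
      using ex_Kirr_dvd g(1) by blast
    then show False
      using no Kirr_square_dvd g(2,3) dvd_trans by blast
  qed
  show "squarefree f"
    unfolding squarefree_def
  proof (intro allI impI)
    fix h assume "h ^ 2 dvd f"
    then obtain v where v: "f = h * h * v"
      by (auto simp: power2_eq_square)
    have "h dvd pderiv f"
      unfolding v pderiv_mult by (auto simp: algebra_simps)
    moreover have "h dvd f"
      by (simp add: v mult.assoc)
    ultimately have "h dvd x * f + y * pderiv f"
      by auto
    then show "h dvd 1"
      using g(4) \<open>g = 1\<close> by simp
  qed
qed

end

section \<open>Additive characters\<close>

text \<open>
  A maximal additive subgroup \<open>H\<close> that misses \<open>1\<close> is a complement of the prime field.  Hence every
  \<open>x\<close> is \<open>h + e\<close> with \<open>h \<in> H\<close> and an integer \<open>e\<close> that is unique modulo \<open>p\<close>, and \<open>x \<mapsto> \<zeta>^e\<close> with a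
  primitive \<open>p\<close>-th root of unity \<open>\<zeta>\<close> is a character.
\<close>
lemma ex_additive_character:
  obtains \<psi> :: "'a :: finite_field \<Rightarrow> complex"
  where "\<And>x y. \<psi> (x + y) = \<psi> x * \<psi> y" "\<And>x. cmod (\<psi> x) = 1" "\<psi> 1 \<noteq> 1"
proof -
  define p where "p = CHAR('a)"
  have p: "prime p"
    by (simp add: p_def)
  then have p2: "p \<ge> 2"
    using prime_ge_2_nat by blast
  define \<H> where "\<H> = {H :: 'a set. 0 \<in> H \<and> (\<forall>x\<in>H. \<forall>y\<in>H. x + y \<in> H) \<and> 1 \<notin> H}"
  have "{0} \<in> \<H>"
    by (auto simp: \<H>_def)
  moreover have "finite \<H>"
    by (rule finite_subset[of _ UNIV]) auto
  ultimately obtain H where H: "H \<in> \<H>" and max: "\<And>H'. H' \<in> \<H> \<Longrightarrow> H \<subseteq> H' \<Longrightarrow> H = H'"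
    using finite_has_maximal[of \<H>] by blast
  have H0: "0 \<in> H" and Hadd: "\<And>x y. x \<in> H \<Longrightarrow> y \<in> H \<Longrightarrow> x + y \<in> H" and H1: "1 \<notin> H"
    using H by (auto simp: \<H>_def)
  have Hmult: "of_nat j * x \<in> H" if "x \<in> H" for j x
    by (induction j) (auto simp: algebra_simps H0 Hadd that)
  have minus_1: "of_nat (p - 1) = (- 1 :: 'a)"
  proof -
    have "of_nat (p - 1) = (of_nat p - 1 :: 'a)"
      using p2 by (simp add: of_nat_diff)
    then show ?thesis
      by (simp add: p_def)
  qed
  have Huminus: "- x \<in> H" if "x \<in> H" for x
    using Hmult[OF that, of "p - 1"] unfolding minus_1 by simp
  have inv: "\<exists>i. of_nat i * of_nat j = (1 :: 'a)" if "of_nat j \<noteq> (0 :: 'a)" for j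
  proof -
    define q where "q = card (UNIV :: 'a set)"
    have "card {0, 1 :: 'a} \<le> q"
      unfolding q_def by (intro card_mono) auto
    then have q: "q = Suc (Suc (q - 2))"
      by simp
    have "(of_nat j :: 'a) * (of_nat j * of_nat j ^ (q - 2)) = of_nat j"
      using finite_field_power_card_eq_same[of "of_nat j :: 'a"] q unfolding q_def[symmetric]
      by (metis power_Suc)
    then have "of_nat (j ^ (q - 2)) * of_nat j = (1 :: 'a)"
      using that by (simp add: mult.commute)
    then show ?thesis by blast
  qed
  have ex: "\<exists>e. x - of_nat e \<in> H" for x
  proof (cases "x \<in> H")
    case True
    then show ?thesis
      by (intro exI[of _ 0]) simp
  next
    case False
    \<comment> \<open>By maximality, the group generated by \<open>H\<close> and \<open>x\<close> contains \<open>1\<close>; solve \<open>1 = h + j x\<close> for \<open>x\<close>.\<close>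
    define H' where "H' = {h + of_nat j * x | h j. h \<in> H}"
    have "H \<subseteq> H'"
    proof
      fix h assume "h \<in> H"
      then show "h \<in> H'"
        unfolding H'_def by (intro CollectI exI[of _ h] exI[of _ 0]) simp
    qed
    moreover have "x \<in> H'"
      unfolding H'_def by (intro CollectI exI[of _ 0] exI[of _ 1]) (simp add: H0)
    moreover have "u + v \<in> H'" if uv: "u \<in> H'" "v \<in> H'" for u v
    proof -
      obtain h j h' j' where "u = h + of_nat j * x" "v = h' + of_nat j' * x" "h \<in> H" "h' \<in> H"
        using uv unfolding H'_def by blast
      then show ?thesis
        unfolding H'_def
        by (intro CollectI exI[of _ "h + h'"] exI[of _ "j + j'"]) (simp add: Hadd algebra_simps)
    qed
    ultimately have "1 \<in> H'"
      using max[of H'] False H0 unfolding \<H>_def by blast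
    then obtain h j where hj: "1 = h + of_nat j * x" "h \<in> H"
      unfolding H'_def by blast
    then have "of_nat j \<noteq> (0 :: 'a)"
      using H1 by auto
    then obtain i where i: "of_nat i * of_nat j = (1 :: 'a)"
      using inv by blast
    have "of_nat i = of_nat i * h + (of_nat i * of_nat j) * x"
      using arg_cong[OF hj(1), of "\<lambda>y. of_nat i * y"] by (simp add: algebra_simps)
    then have "x - of_nat i = - (of_nat i * h)"
      by (simp add: i algebra_simps)
    then have "x - of_nat i \<in> H"
      using Huminus[OF Hmult[OF hj(2)]] by simp
    then show ?thesis by blast
  qed
  have uniq: "[e = e'] (mod p)" if e: "x - of_nat e \<in> H" "x - of_nat e' \<in> H" for x e e'
  proof -
    have *: "of_nat d = (0 :: 'a)" if "of_nat d \<in> H" for d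
      using inv[of d] Hmult[OF that] H1 by metis
    have "of_nat (e' + (p - 1) * e) = (x - of_nat e) + - (x - of_nat e')"
      by (simp only: of_nat_add of_nat_mult minus_1) simp
    then have "of_nat (e' + (p - 1) * e) \<in> H"
      using Hadd[OF e(1) Huminus[OF e(2)]] by metis
    then have "of_nat (e' + (p - 1) * e) = (0 :: 'a)"
      by (rule *)
    then have "(of_nat e :: 'a) = of_nat e'"
      by (simp only: of_nat_add of_nat_mult minus_1) simp
    then show ?thesis
      by (simp add: of_nat_eq_iff_cong_CHAR p_def)
  qed
  define e where "e = (\<lambda>x. SOME e. x - of_nat e \<in> H)"
  have e: "x - of_nat (e x) \<in> H" for x
    unfolding e_def using ex by (rule someI_ex)
  define \<zeta> where "\<zeta> = cis (2 * pi / real p)"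
  have "\<zeta> ^ p = 1"
    using p2 by (simp add: \<zeta>_def DeMoivre)
  then have \<zeta>: "\<zeta> ^ a = \<zeta> ^ b" if "[a = b] (mod p)" for a b
  proof -
    have "\<zeta> ^ a = \<zeta> ^ (a mod p)" for a
    proof -
      have "\<zeta> ^ a = \<zeta> ^ (p * (a div p) + a mod p)"
        by simp
      also have "\<dots> = \<zeta> ^ (a mod p)"
        unfolding power_add power_mult \<open>\<zeta> ^ p = 1\<close> by simp
      finally show ?thesis .
    qed
    then show ?thesis
      using that unfolding unique_euclidean_semiring_class.cong_def by metis
  qed
  show ?thesis
  proof (rule that[of "\<lambda>x. \<zeta> ^ e x"])
    fix x y
    have "(x + y) - of_nat (e x + e y) = (x - of_nat (e x)) + (y - of_nat (e y))"
      by simp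
    then have "(x + y) - of_nat (e x + e y) \<in> H"
      using Hadd e by metis
    then have "[e (x + y) = e x + e y] (mod p)"
      using uniq e by blast
    then show "\<zeta> ^ e (x + y) = \<zeta> ^ e x * \<zeta> ^ e y"
      using \<zeta> by (simp flip: power_add)
  next
    show "cmod (\<zeta> ^ e x) = 1" for x
      by (simp add: \<zeta>_def norm_power)
  next
    have "[e 1 = 1] (mod p)"
      using uniq[OF e, of 1 1] H0 by simp
    then have "\<zeta> ^ e 1 = \<zeta>"
      using \<zeta>[of "e 1" 1] by simp
    moreover have "\<zeta> \<noteq> 1"
    proof
      assume "\<zeta> = 1"
      then have "cos (2 * pi / real p) = 1"
        by (simp add: \<zeta>_def complex_eq_iff)
      then obtain k :: int where "2 * pi / real p = real_of_int k * 2 * pi"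
        by (auto simp: cos_one_2pi_int)
      then have "real_of_int k * real p = 1"
        using p2 by (simp add: field_simps)
      then have "k * int p = 1"
        by (metis of_int_1 of_int_eq_iff of_int_mult of_int_of_nat_eq)
      then have "int p dvd 1"
        by (metis dvd_triv_right)
      then show False
        using p2 by simp
    qed
    ultimately show "\<zeta> ^ e 1 \<noteq> 1" by simp
  qed
qed

lemma norm_add_unit_less:
  assumes "cmod z = 1" "cmod w = 1" "z \<noteq> w"
  shows "cmod (z + w) < 2"
proof -
  have "(cmod (z + w))\<^sup>2 + (cmod (z - w))\<^sup>2 = 2 * (cmod z)\<^sup>2 + 2 * (cmod w)\<^sup>2"
    by (simp only: cmod_power2) (simp add: power2_eq_square algebra_simps)
  then have "(cmod (z + w))\<^sup>2 + (cmod (z - w))\<^sup>2 = 4"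
    using assms by simp
  moreover have "(cmod (z - w))\<^sup>2 > 0"
    using assms(3) by simp
  ultimately have "(cmod (z + w))\<^sup>2 < 4"
    by linarith
  then have "(cmod (z + w))\<^sup>2 < 2\<^sup>2"
    by simp
  then show ?thesis
    by (rule power_less_imp_less_base) simp
qed

text \<open>
  Every subfield contains \<open>1\<close>, so \<open>\<psi> 1 \<noteq> 1\<close> makes one and the same \<open>\<psi>\<close> nontrivial on all subfields.
\<close>
locale additive_character =
  fixes \<psi> :: "'a :: finite_field \<Rightarrow> complex"
  assumes \<psi>_add: "\<psi> (x + y) = \<psi> x * \<psi> y"
    and norm_\<psi>: "cmod (\<psi> x) = 1"
    and \<psi>_1: "\<psi> 1 \<noteq> 1"
begin

lemma \<psi>_0 [simp]: "\<psi> 0 = 1"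
proof -
  have "\<psi> 0 * \<psi> 0 = \<psi> 0"
    using \<psi>_add[of 0 0] by simp
  moreover have "\<psi> 0 \<noteq> 0"
    using norm_\<psi>[of 0] by auto
  ultimately show ?thesis by simp
qed

lemma \<psi>_sum: "\<psi> (sum f I) = (\<Prod>i\<in>I. \<psi> (f i))"
  by (induction I rule: infinite_finite_induct) (auto simp: \<psi>_add)

lemma \<psi>_of_nat_mult: "\<psi> (of_nat n * x) = \<psi> x ^ n"
  by (induction n) (auto simp: \<psi>_add algebra_simps)

lemma \<psi>_uminus: "\<psi> (- x) = inverse (\<psi> x)"
  using \<psi>_add[of x "- x"] by (simp add: inverse_unique)

lemma \<psi>_of_int_mult: "\<psi> x = 1 \<Longrightarrow> \<psi> (of_int n * x) = 1"
  by (cases n) (auto simp: \<psi>_of_nat_mult \<psi>_uminus simp del: of_nat_Suc)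

text \<open>
  There are finitely many sets \<open>D\<close> and elements \<open>c\<close>, so strict inequalities improve to a uniform
  factor, which depends on the big field only.
\<close>
lemma ex_uniform_decay:
  "\<exists>\<rho>. 0 < \<rho> \<and> \<rho> < 1 \<and>
     (\<forall>D c. cmod (\<Sum>a\<in>D. \<psi> (a * c)) < real (card D) \<longrightarrow> cmod (\<Sum>a\<in>D. \<psi> (a * c)) \<le> \<rho> * real (card D))"
proof -
  define T where "T = (\<lambda>(D, c). cmod (\<Sum>a\<in>D. \<psi> (a * c)) / card D) ` (UNIV :: ('a set \<times> 'a) set)"
  define \<rho> where "\<rho> = Max (insert (1/2) {x \<in> T. x < 1})"
  have fin: "finite (insert (1/2) {x \<in> T. x < 1})"
    by (simp add: T_def)
  have "\<rho> < 1"
    unfolding \<rho>_def using fin by (subst Max_less_iff) auto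
  moreover have "1/2 \<le> \<rho>"
    unfolding \<rho>_def using fin by (intro Max_ge) auto
  moreover have "cmod (\<Sum>a\<in>D. \<psi> (a * c)) \<le> \<rho> * real (card D)"
    if "cmod (\<Sum>a\<in>D. \<psi> (a * c)) < card D" for D c
  proof -
    have pos: "real (card D) > 0"
      using that norm_ge_zero[of "\<Sum>a\<in>D. \<psi> (a * c)"] by linarith
    have "cmod (\<Sum>a\<in>D. \<psi> (a * c)) / card D \<in> T"
      unfolding T_def by (rule image_eqI[of _ _ "(D, c)"]) auto
    moreover have "cmod (\<Sum>a\<in>D. \<psi> (a * c)) / card D < 1"
      using that pos by (simp add: divide_less_eq)
    ultimately have "cmod (\<Sum>a\<in>D. \<psi> (a * c)) / card D \<le> \<rho>"
      unfolding \<rho>_def using fin by (intro Max_ge) auto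
    then show ?thesis
      using pos by (simp add: divide_le_eq)
  qed
  ultimately show ?thesis
    by (intro exI[of _ \<rho>]) auto
qed

end

locale subfield_character = finite_subfield K + additive_character \<psi>
  for K :: "'a :: finite_field set" and \<psi> :: "'a \<Rightarrow> complex"
begin

lemma character_orthogonality:
  assumes "h \<in> K"
  shows "(\<Sum>b\<in>K. \<psi> (b * h)) = (if h = 0 then of_nat (card K) else 0)"
proof (cases "h = 0")
  case False
  define S where "S = (\<Sum>b\<in>K. \<psi> b)"
  have "S = (\<Sum>b\<in>K. \<psi> (b + 1))"
    unfolding S_def
    by (rule sum.reindex_bij_witness[of _ "\<lambda>b. b + 1" "\<lambda>b. b - 1"]) auto
  also have "\<dots> = \<psi> 1 * S"
    by (simp add: S_def \<psi>_add sum_distrib_left mult.commute)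
  finally have "S = 0"
    using \<psi>_1 by simp
  moreover have "(\<Sum>b\<in>K. \<psi> (b * h)) = S"
    unfolding S_def
    by (rule sum.reindex_bij_witness[of _ "\<lambda>b. b / h" "\<lambda>b. b * h"]) (use False assms in auto)
  ultimately show ?thesis
    using False by simp
qed simp

text \<open>
  Equality in the triangle inequality would make \<open>a \<mapsto> \<psi> (a c)\<close> constant on \<open>D\<close>.  Then \<open>D\<close> would lie
  in a translate of the subspace \<open>{x. \<psi> (x c) = 1}\<close> of \<open>K\<close>, which is proper because it misses \<open>1 / c\<close>.
\<close>
lemma character_sum_less:
  assumes D: "D \<subseteq> K" "\<not> (\<exists>A. proper_affine_subspace_of K A \<and> D \<subseteq> A)"
    and c: "c \<in> K" "c \<noteq> 0"
  shows "cmod (\<Sum>a\<in>D. \<psi> (a * c)) < card D"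
proof -
  define V where "V = {x \<in> K. \<psi> (x * c) = 1}"
  have V: "Fp_subspace V"
  proof -
    have "of_int n \<in> K" for n :: int
      by (cases n) (auto simp del: of_nat_Suc)
    then show ?thesis
      by (auto simp: Fp_subspace_def V_def prime_subfield_def \<psi>_add distrib_right
            mult.assoc \<psi>_of_int_mult)
  qed
  have "inverse c \<notin> V"
    using c \<psi>_1 by (simp add: V_def)
  have aff: "proper_affine_subspace_of K ((+) a ` V)" if a: "a \<in> K" for a
  proof -
    have "(+) a ` V \<noteq> K"
    proof
      assume "(+) a ` V = K"
      then have "a + inverse c \<in> (+) a ` V"
        using a c by auto
      then show False
        using \<open>inverse c \<notin> V\<close> by auto
    qed
    then show ?thesis
      unfolding proper_affine_subspace_of_def affine_subspace_of_def
      using V a by (intro conjI bexI[of _ a] exI[of _ V]) (auto simp: V_def)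
  qed
  then have notin: "\<not> D \<subseteq> (+) a ` V" if "a \<in> K" for a
    using D(2) that by blast
  have "D \<noteq> {}"
    using notin[of 0] by auto
  then obtain a where a: "a \<in> D" by auto
  then obtain b where b: "b \<in> D" "b \<notin> (+) a ` V"
    using notin[of a] D(1) by blast
  have "b - a \<notin> V"
    using b(2) by (metis add.commute diff_add_cancel imageI)
  then have "\<psi> ((b - a) * c) \<noteq> 1"
    using a b D(1) by (auto simp: V_def)
  then have ne: "\<psi> (a * c) \<noteq> \<psi> (b * c)"
    using \<psi>_add[of "(b - a) * c" "a * c"] norm_\<psi>[of "a * c"] by (auto simp: algebra_simps)
  then have ab: "a \<noteq> b" by auto
  have "(\<Sum>x\<in>D. \<psi> (x * c)) = (\<psi> (a * c) + \<psi> (b * c)) + (\<Sum>x\<in>D-{a,b}. \<psi> (x * c))"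
    using a b ab by (simp add: sum.remove[of D a] sum.remove[of "D - {a}" b] Diff_insert2[symmetric])
  also have "cmod \<dots> \<le> cmod (\<psi> (a * c) + \<psi> (b * c)) + (\<Sum>x\<in>D-{a,b}. cmod (\<psi> (x * c)))"
    by (intro norm_triangle_le add_left_mono sum_norm_le order.refl)
  also have "\<dots> < 2 + (\<Sum>x\<in>D-{a,b}. cmod (\<psi> (x * c)))"
    using norm_add_unit_less[OF norm_\<psi> norm_\<psi> ne] by simp
  also have "\<dots> = card D"
  proof -
    have "card {a, b} \<le> card D"
      using a b by (intro card_mono) auto
    then show ?thesis
      using a b ab by (simp add: norm_\<psi> card_Diff_subset of_nat_diff)
  qed
  finally show ?thesis .
qed

end

section \<open>Equidistribution of products of coefficient sets modulo polynomials\<close>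

definition monic_poly_of :: "nat \<Rightarrow> (nat \<Rightarrow> 'a) \<Rightarrow> 'a :: comm_ring_1 poly" where
  "monic_poly_of n a = monom 1 n + (\<Sum>i<n. monom (a i) i)"

lemma coeff_monic_poly_of:
  "coeff (monic_poly_of n a) i = (if i < n then a i else if i = n then 1 else 0)"
  by (auto simp: monic_poly_of_def coeff_sum)

lemma degree_monic_poly_of: "degree (monic_poly_of n a) = n"
  and lead_coeff_monic_poly_of: "lead_coeff (monic_poly_of n a) = 1"
proof -
  show *: "degree (monic_poly_of n a) = n"
    by (intro antisym degree_le le_degree) (auto simp: coeff_monic_poly_of)
  show "lead_coeff (monic_poly_of n a) = 1"
    unfolding * by (simp add: coeff_monic_poly_of)
qed

context finite_subfield
begin

lemma monic_poly_of_Kmonic: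
  assumes "a \<in> PiE {..<n} D" "\<And>i. i < n \<Longrightarrow> D i \<subseteq> K"
  shows "monic_poly_of n a \<in> Kmonic"
  using assms lead_coeff_monic_poly_of[of n a]
  by (auto simp: Kmonic_def KX_def coeff_monic_poly_of PiE_iff)

text \<open>
  As \<open>b\<close> ranges over \<open>K^(degree g)\<close>, the maps \<open>h \<mapsto> \<psi> (residue_functional g b h)\<close> are the characters of
  the additive group of \<open>K[X] / (g)\<close>.
\<close>
definition residue_functional :: "'a poly \<Rightarrow> (nat \<Rightarrow> 'a) \<Rightarrow> 'a poly \<Rightarrow> 'a" where
  "residue_functional g b h = (\<Sum>j<degree g. b j * coeff (h mod g) j)"

lemma residue_functional_add:
  "residue_functional g b (f + h) = residue_functional g b f + residue_functional g b h"
  by (simp add: residue_functional_def poly_mod_add_left algebra_simps sum.distrib)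

lemma residue_functional_smult:
  "residue_functional g b (smult c h) = c * residue_functional g b h"
  by (simp add: residue_functional_def mod_smult_left algebra_simps sum_distrib_left)

lemma residue_functional_0 [simp]: "residue_functional g b 0 = 0"
  by (simp add: residue_functional_def)

lemma residue_functional_sum:
  "residue_functional g b (sum f I) = (\<Sum>i\<in>I. residue_functional g b (f i))"
  by (induction I rule: infinite_finite_induct) (auto simp: residue_functional_add)

lemma residue_functional_monom:
  "residue_functional g b (monom c i) = c * residue_functional g b (monom 1 i)"
  using residue_functional_smult[of g b c "monom 1 i"] by (simp add: smult_monom)

lemma residue_functional_in_K:
  assumes "g \<in> Kmonic" "b \<in> PiE {..<degree g} (\<lambda>_. K)" "h \<in> KX"
  shows "residue_functional g b h \<in> K"
proof -
  have "h mod g \<in> KX"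
    using KX_division assms KmonicD by blast
  then show ?thesis
    using assms(2) unfolding residue_functional_def KX_def by (intro K_sum) auto
qed

text \<open>
  The values \<open>c\<^sub>i\<close> of a residue functional at \<open>t^i\<close> form a linear recurrence with characteristic
  polynomial \<open>g\<close>.  As the constant coefficient of \<open>g\<close> is nonzero, the recurrence can be run
  backwards, so a window of \<open>degree g\<close> consecutive zeros forces the initial values, which are the
  \<open>b j\<close>, to vanish.
\<close>
lemma residue_functional_window:
  assumes g: "g \<in> Kmonic" "coeff g 0 \<noteq> 0"
    and zero: "\<And>j. j < degree g \<Longrightarrow> residue_functional g b (monom 1 (i + j)) = 0"
    and j: "j < degree g"
  shows "b j = 0"
proof -
  let ?L = "\<lambda>i. residue_functional g b (monom 1 i)"
  have "\<forall>j<degree g. ?L j = 0"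
    using zero
  proof (induction i)
    case 0
    then show ?case by simp
  next
    case (Suc i)
    have "monom 1 i * g = monom 1 i * (\<Sum>j\<le>degree g. monom (coeff g j) j)"
      by (simp only: poly_as_sum_of_monoms)
    also have "\<dots> = (\<Sum>j\<le>degree g. monom (coeff g j) (i + j))"
      by (simp add: sum_distrib_left mult_monom)
    finally have "monom 1 i * g = (\<Sum>j\<le>degree g. monom (coeff g j) (i + j))" .
    then have "residue_functional g b (monom 1 i * g) = (\<Sum>j\<le>degree g. coeff g j * ?L (i + j))"
      by (simp add: residue_functional_sum residue_functional_monom[of g b "coeff g _"])
    moreover have "residue_functional g b (monom 1 i * g) = 0"
      by (simp add: residue_functional_def)
    ultimately have "(\<Sum>j\<le>degree g. coeff g j * ?L (i + j)) = 0"
      by simp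
    moreover have "(\<Sum>j\<le>degree g. coeff g j * ?L (i + j)) = coeff g 0 * ?L i"
    proof -
      have "(\<Sum>j\<le>degree g. coeff g j * ?L (i + j)) = (\<Sum>j\<in>{0}. coeff g j * ?L (i + j))"
      proof (intro sum.mono_neutral_right ballI)
        fix j assume "j \<in> {..degree g} - {0}"
        then obtain j' where "j = Suc j'" "j' < degree g"
          by (cases j) auto
        then show "coeff g j * ?L (i + j) = 0"
          using Suc.prems[of j'] by simp
      qed auto
      then show ?thesis by simp
    qed
    ultimately have "?L i = 0"
      using g(2) by simp
    have "?L (i + j) = 0" if "j < degree g" for j
    proof (cases j)
      case 0
      then show ?thesis using \<open>?L i = 0\<close> by simp
    next
      case (Suc j')
      then show ?thesis using Suc.prems[of j'] that by simp
    qed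
    then show ?case
      by (rule Suc.IH)
  qed
  then have "?L j = 0"
    using j by blast
  moreover have "monom 1 j mod g = monom (1 :: 'a) j"
    using j by (intro mod_poly_less) (simp add: degree_monom_eq)
  then have "?L j = (\<Sum>j'<degree g. if j' = j then b j else 0)"
    unfolding residue_functional_def by (intro sum.cong) auto
  then have "?L j = b j"
    using j by simp
  ultimately show ?thesis by simp
qed

lemma card_residue_functional_nonzero:
  assumes g: "g \<in> Kmonic" "coeff g 0 \<noteq> 0" and b: "j < degree g" "b j \<noteq> 0"
  shows "(n - l) div degree g \<le> card {i. l \<le> i \<and> i < n \<and> residue_functional g b (monom 1 i) \<noteq> 0}"
    (is "?N \<le> card ?Z")
proof -
  define r where "r = degree g"
  have "\<exists>i. i < r \<and> residue_functional g b (monom 1 (l + w * r + i)) \<noteq> 0" for w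
    using residue_functional_window[OF g, of b "l + w * r" j] b unfolding r_def by blast
  then obtain i where i: "\<And>w. i w < r" "\<And>w. residue_functional g b (monom 1 (l + w * r + i w)) \<noteq> 0"
    by metis
  define h where "h = (\<lambda>w. l + w * r + i w)"
  have "w = (h w - l) div r" for w
    using i(1)[of w] by (simp add: h_def)
  then have "inj_on h {..<?N}"
    by (intro inj_onI) metis
  then have "card (h ` {..<?N}) = ?N"
    by (simp add: card_image)
  moreover have "h ` {..<?N} \<subseteq> ?Z"
  proof
    fix x assume "x \<in> h ` {..<?N}"
    then obtain w where w: "w < (n - l) div r" "x = h w"
      unfolding r_def by auto
    have "(w + 1) * r \<le> ((n - l) div r) * r"
      using w by (intro mult_le_mono1) simp
    also have "\<dots> \<le> n - l"
      by simp
    finally have "l + w * r + i w < n"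
      using i(1)[of w] by simp
    then show "x \<in> ?Z"
      using i w by (simp add: h_def)
  qed
  moreover have "finite ?Z"
    by (rule finite_subset[of _ "{..<n}"]) auto
  ultimately show ?thesis
    by (metis card_mono)
qed

end

context subfield_character
begin

text \<open>
  The sum factors over the coefficients of the residue of \<open>h\<close>, and each factor is an orthogonality
  sum that tests whether the coefficient is zero.
\<close>
lemma residue_indicator:
  assumes g: "g \<in> Kmonic" and h: "h \<in> KX"
  shows "(\<Sum>b\<in>PiE {..<degree g} (\<lambda>_. K). \<psi> (residue_functional g b h)) =
           (if g dvd h then of_nat (card K ^ degree g) else 0)"
proof -
  have hK: "coeff (h mod g) j \<in> K" for j
    using KX_division[OF h, of g] KmonicD[OF g] by (auto simp: KX_def)
  have "(\<Sum>b\<in>PiE {..<degree g} (\<lambda>_. K). \<psi> (residue_functional g b h)) =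
        (\<Sum>b\<in>PiE {..<degree g} (\<lambda>_. K). \<Prod>j<degree g. \<psi> (b j * coeff (h mod g) j))"
    by (simp add: residue_functional_def \<psi>_sum)
  also have "\<dots> = (\<Prod>j<degree g. \<Sum>b\<in>K. \<psi> (b * coeff (h mod g) j))"
    by (subst prod_sum_PiE) auto
  also have "\<dots> = (\<Prod>j<degree g. if coeff (h mod g) j = 0 then of_nat (card K) else 0)"
    using hK by (simp add: character_orthogonality)
  also have "\<dots> = (if g dvd h then of_nat (card K ^ degree g) else 0)"
  proof (cases "g dvd h")
    case True
    then show ?thesis by simp
  next
    case False
    then have "h mod g \<noteq> 0" by auto
    moreover have "degree (h mod g) < degree g"
      using degree_mod_less[of g h] \<open>h mod g \<noteq> 0\<close> KmonicD(3)[OF g] by auto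
    ultimately show ?thesis
      using False by (intro trans[OF prod_zero]) (auto intro!: bexI[of _ "degree (h mod g)"])
  qed
  finally show ?thesis .
qed

text \<open>
  Only the coefficients from index \<open>l\<close> on are required to have spread-out values; the first \<open>l\<close>
  may be frozen.  The trivial character \<open>b = 0\<close> gives the main term.  For the others the character
  sum factors over the coefficients of \<open>f\<close>, and each window of \<open>degree g\<close> indices saves a factor \<open>\<rho>\<close>.
\<close>
lemma equidistribution:
  fixes D :: "nat \<Rightarrow> 'a set"
  assumes D: "\<And>i. i < n \<Longrightarrow> D i \<subseteq> K"
    and \<rho>: "0 < \<rho>" "\<rho> < 1"
    and decay: "\<And>i c. l \<le> i \<Longrightarrow> i < n \<Longrightarrow> c \<in> K - {0} \<Longrightarrow>
                  cmod (\<Sum>a\<in>D i. \<psi> (a * c)) \<le> \<rho> * real (card (D i))"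
    and g: "g \<in> Kmonic" "coeff g 0 \<noteq> 0"
  defines "W \<equiv> real (\<Prod>i<n. card (D i))"
  shows "\<bar>real (card {a \<in> PiE {..<n} D. g dvd monic_poly_of n a}) - W / real (card K) ^ degree g\<bar>
           \<le> W * \<rho> ^ ((n - l) div degree g)"
proof -
  define r where "r = degree g"
  define B where "B = PiE {..<r} (\<lambda>_. K)"
  define e where "e = (n - l) div r"
  define L where "L = (\<lambda>b i. residue_functional g b (monom 1 i))"
  define N where "N = card {a \<in> PiE {..<n} D. g dvd monic_poly_of n a}"
  define F where "F = (\<lambda>b. \<psi> (L b n) * (\<Prod>i<n. \<Sum>x\<in>D i. \<psi> (x * L b i)))"
  define b0 where "b0 = (\<lambda>j\<in>{..<r}. 0 :: 'a)"
  have W0: "W \<ge> 0"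
    by (simp add: W_def prod_nonneg)
  have finB: "finite B"
    unfolding B_def by (intro finite_PiE) auto
  have cardB: "card B = card K ^ r"
    unfolding B_def by (simp add: card_PiE)
  have Q: "real (card K) ^ r > 0"
    using card_K_ge_2 by simp
  have b0: "b0 \<in> B"
    by (auto simp: b0_def B_def)
  have finP: "finite (PiE {..<n} D)"
    by (intro finite_PiE) auto
  have LK: "L b i \<in> K" if "b \<in> B" for b i
    unfolding L_def using that g by (intro residue_functional_in_K) (auto simp: B_def r_def)
  have "complex_of_nat (card K ^ r * N) =
          (\<Sum>a\<in>PiE {..<n} D. if g dvd monic_poly_of n a then of_nat (card K ^ r) else 0)"
    unfolding N_def using finP by (subst sum.inter_filter[symmetric]) auto
  also have "\<dots> = (\<Sum>a\<in>PiE {..<n} D. \<Sum>b\<in>B. \<psi> (residue_functional g b (monic_poly_of n a)))"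
  proof (intro sum.cong refl)
    fix a assume "a \<in> PiE {..<n} D"
    then have "monic_poly_of n a \<in> KX"
      using D by (intro KmonicD(1) monic_poly_of_Kmonic)
    then show "(if g dvd monic_poly_of n a then of_nat (card K ^ r) else 0) =
                 (\<Sum>b\<in>B. \<psi> (residue_functional g b (monic_poly_of n a)))"
      unfolding B_def r_def by (rule residue_indicator[OF g(1), symmetric])
  qed
  also have "\<dots> = (\<Sum>b\<in>B. \<Sum>a\<in>PiE {..<n} D. \<psi> (residue_functional g b (monic_poly_of n a)))"
    by (rule sum.swap)
  also have "\<dots> = (\<Sum>b\<in>B. F b)"
  proof (intro sum.cong refl)
    fix b
    have "\<psi> (residue_functional g b (monic_poly_of n a)) = \<psi> (L b n) * (\<Prod>i<n. \<psi> (a i * L b i))" for a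
    proof -
      have "residue_functional g b (monic_poly_of n a) = L b n + (\<Sum>i<n. a i * L b i)"
        unfolding monic_poly_of_def L_def
        by (simp add: residue_functional_add residue_functional_sum
              residue_functional_monom[of g b "a _"])
      then show ?thesis
        by (simp add: \<psi>_add \<psi>_sum)
    qed
    then show "(\<Sum>a\<in>PiE {..<n} D. \<psi> (residue_functional g b (monic_poly_of n a))) = F b"
      unfolding F_def by (subst prod_sum_PiE) (auto simp: sum_distrib_left)
  qed
  also have "\<dots> = F b0 + (\<Sum>b\<in>B-{b0}. F b)"
    using finB b0 by (simp add: sum.remove)
  also have "F b0 = of_real W"
  proof -
    have "L b0 i = 0" for i
      unfolding L_def residue_functional_def r_def[symmetric] by (intro sum.neutral) (auto simp: b0_def)
    then show ?thesis
      by (simp add: F_def W_def)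
  qed
  finally have eq: "complex_of_nat (card K ^ r * N) - of_real W = (\<Sum>b\<in>B-{b0}. F b)"
    by simp
  have bound: "cmod (F b) \<le> W * \<rho> ^ e" if b: "b \<in> B - {b0}" for b
  proof -
    define Z where "Z = {i. l \<le> i \<and> i < n \<and> L b i \<noteq> 0}"
    have "\<exists>j<r. b j \<noteq> 0"
    proof (rule ccontr)
      assume "\<not> ?thesis"
      then have "b = b0"
        using b unfolding B_def b0_def by (intro ext) (auto simp: PiE_iff extensional_def)
      with b show False by simp
    qed
    then have e: "e \<le> card Z"
      unfolding e_def Z_def L_def r_def using card_residue_functional_nonzero[OF g] by blast
    have "cmod (F b) = (\<Prod>i<n. cmod (\<Sum>x\<in>D i. \<psi> (x * L b i)))"
      by (simp add: F_def norm_mult norm_\<psi> prod_norm)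
    also have "\<dots> \<le> (\<Prod>i<n. (if i \<in> Z then \<rho> else 1) * real (card (D i)))"
    proof (intro prod_mono conjI norm_ge_zero)
      fix i assume i: "i \<in> {..<n}"
      have "cmod (\<Sum>x\<in>D i. \<psi> (x * L b i)) \<le> (\<Sum>x\<in>D i. 1)"
        by (intro sum_norm_le) (simp add: norm_\<psi>)
      then show "cmod (\<Sum>x\<in>D i. \<psi> (x * L b i)) \<le> (if i \<in> Z then \<rho> else 1) * real (card (D i))"
        using decay[of i "L b i"] LK[of b i] b i by (auto simp: Z_def)
    qed
    also have "\<dots> = (\<Prod>i<n. if i \<in> Z then \<rho> else 1) * W"
      by (simp add: prod.distrib W_def)
    also have "(\<Prod>i<n. if i \<in> Z then \<rho> else 1) = \<rho> ^ card Z"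
    proof -
      have "{..<n} \<inter> Z = Z"
        by (auto simp: Z_def)
      then show ?thesis
        using prod.inter_restrict[of "{..<n}" "\<lambda>_. \<rho>" Z] by simp
    qed
    also have "\<rho> ^ card Z * W \<le> \<rho> ^ e * W"
      using e \<rho> W0 by (intro mult_right_mono power_decreasing) auto
    finally show ?thesis
      by (simp add: mult.commute)
  qed
  have "\<bar>real (card K ^ r * N) - W\<bar> = cmod (complex_of_nat (card K ^ r * N) - of_real W)"
  proof -
    have "complex_of_nat (card K ^ r * N) - of_real W = of_real (real (card K ^ r * N) - W)"
      by simp
    then show ?thesis
      by (simp only: norm_of_real)
  qed
  also have "\<dots> \<le> (\<Sum>b\<in>B-{b0}. W * \<rho> ^ e)"
    unfolding eq by (intro sum_norm_le bound)
  also have "\<dots> \<le> real (card K) ^ r * (W * \<rho> ^ e)"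
  proof -
    have "card (B - {b0}) \<le> card B"
      using finB by (intro card_mono) auto
    then have "real (card (B - {b0})) \<le> real (card K) ^ r"
      by (metis cardB of_nat_le_iff of_nat_power)
    then show ?thesis
      using \<rho> W0 by (simp add: mult_right_mono)
  qed
  finally have "\<bar>real (card K) ^ r * real N - W\<bar> \<le> real (card K) ^ r * (W * \<rho> ^ e)"
    by simp
  moreover have "real N - W / real (card K) ^ r = (real (card K) ^ r * real N - W) / real (card K) ^ r"
    unfolding diff_divide_distrib using Q by (subst nonzero_mult_div_cancel_left) auto
  ultimately have "\<bar>real N - W / real (card K) ^ r\<bar> \<le> W * \<rho> ^ e"
    using Q by (simp add: abs_divide pos_divide_le_eq mult.commute)
  then show ?thesis
    unfolding N_def r_def e_def .
qed

end

section \<open>A truncated sieve\<close>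

text \<open>
  Without the condition on the weight the alternating sum is \<open>1\<close> for \<open>X = {}\<close> and \<open>0\<close> otherwise.
  Adding an element \<open>x\<close> to a nonempty \<open>X\<close> replaces the truncated sum \<open>T y\<close> by \<open>T y - T (y - w x)\<close>, while the
  number of sets with weight in \<open>{y<..y + z}\<close>, say \<open>N y\<close>, becomes \<open>N y + N (y - w x)\<close>; so the bound is
  inherited.  If \<open>w x > y\<close>, the sets containing \<open>x\<close> do not enter the sum at all; the only case to
  watch is \<open>X = {}\<close>, where \<open>{x}\<close> itself, of weight at most \<open>z\<close>, accounts for the error.
\<close>
lemma truncated_sieve:
  fixes w :: "'b \<Rightarrow> nat"
  assumes "finite X" "\<And>x. x \<in> X \<Longrightarrow> w x \<le> z"
  shows "\<bar>(\<Sum>A | A \<subseteq> X \<and> sum w A \<le> y. (- 1) ^ card A) - (if X = {} then 1 else 0)\<bar>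
           \<le> real (card {A. A \<subseteq> X \<and> y < sum w A \<and> sum w A \<le> y + z})"
  using assms
proof (induction X arbitrary: y rule: finite_induct)
  case empty
  have "{A :: 'b set. A \<subseteq> {} \<and> sum w A \<le> y} = {{}}"
    by auto
  then show ?case by simp
next
  case (insert x X)
  define T where "T = (\<lambda>X y. \<Sum>A | A \<subseteq> X \<and> sum w A \<le> y. (- 1 :: real) ^ card A)"
  define N where "N = (\<lambda>X y. card {A. A \<subseteq> X \<and> y < sum w A \<and> sum w A \<le> y + z})"
  have IH: "\<bar>T X y - (if X = {} then 1 else 0)\<bar> \<le> real (N X y)" for y
    unfolding T_def N_def using insert.IH insert.prems by simp
  have fin: "finite {A. A \<subseteq> X \<and> R A}" for R
    using insert.hyps by (auto intro: rev_finite_subset[of "Pow X"])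
  have inj: "inj_on (insert x) {A. A \<subseteq> X \<and> R A}" for R
    using insert.hyps by (intro inj_onI) (auto simp: insert_ident subset_iff)
  have card_ins: "card (insert x A) = Suc (card A)" and sum_ins: "sum w (insert x A) = w x + sum w A"
    if "A \<subseteq> X" for A
  proof -
    have "finite A" "x \<notin> A"
      using that insert.hyps finite_subset[of A X] by auto
    then show "card (insert x A) = Suc (card A)" "sum w (insert x A) = w x + sum w A"
      by simp_all
  qed
  have split: "{A. A \<subseteq> insert x X \<and> R (sum w A)} =
      {A. A \<subseteq> X \<and> R (sum w A)} \<union> insert x ` {A. A \<subseteq> X \<and> R (w x + sum w A)}" (is "?l = ?r") for R
  proof
    show "?l \<subseteq> ?r"
    proof
      fix A assume A: "A \<in> ?l"
      show "A \<in> ?r"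
      proof (cases "x \<in> A")
        case True
        then have "A = insert x (A - {x})" "A - {x} \<subseteq> X"
          using A by auto
        then show ?thesis
          using A sum_ins[of "A - {x}"] by (intro UnI2 image_eqI[of _ _ "A - {x}"]) auto
      qed (use A in auto)
    qed
    show "?r \<subseteq> ?l"
      using sum_ins by auto
  qed
  have disj: "{A. A \<subseteq> X \<and> R A} \<inter> insert x ` {A. A \<subseteq> X \<and> R' A} = {}" for R R'
    using insert.hyps by auto
  have T: "T (insert x X) y = T X y - (\<Sum>A | A \<subseteq> X \<and> w x + sum w A \<le> y. (- 1) ^ card A)"
  proof -
    have "T (insert x X) y = T X y + (\<Sum>A\<in>insert x ` {A. A \<subseteq> X \<and> w x + sum w A \<le> y}. (- 1) ^ card A)"
      unfolding T_def split[of "\<lambda>s. s \<le> y"] by (intro sum.union_disjoint finite_imageI fin disj)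
    also have "(\<Sum>A\<in>insert x ` {A. A \<subseteq> X \<and> w x + sum w A \<le> y}. (- 1 :: real) ^ card A) =
                 (\<Sum>A | A \<subseteq> X \<and> w x + sum w A \<le> y. - ((- 1) ^ card A))"
      by (subst sum.reindex[OF inj]) (auto intro!: sum.cong simp: card_ins)
    finally show ?thesis
      by (simp add: sum_negf)
  qed
  have N: "N (insert x X) y = N X y + card {A. A \<subseteq> X \<and> y < w x + sum w A \<and> w x + sum w A \<le> y + z}"
    unfolding N_def split[of "\<lambda>s. y < s \<and> s \<le> y + z"]
    by (subst card_Un_disjoint) (auto intro!: finite_imageI fin disj card_image inj)
  show ?case
  proof (cases "w x \<le> y")
    case True
    have "(w x + s \<le> y) = (s \<le> y - w x)"
      and "(y < w x + s \<and> w x + s \<le> y + z) = (y - w x < s \<and> s \<le> (y - w x) + z)" for s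
      using True by auto
    then have "T (insert x X) y = T X y - T X (y - w x)" "N (insert x X) y = N X y + N X (y - w x)"
      unfolding T N by (simp_all add: T_def N_def)
    then have "\<bar>T (insert x X) y\<bar> \<le> real (N (insert x X) y)"
      using IH[of y] IH[of "y - w x"] by linarith
    then show ?thesis
      by (simp add: T_def N_def)
  next
    case False
    then have no: "{A. A \<subseteq> X \<and> w x + sum w A \<le> y} = {}"
      by auto
    have "T (insert x X) y = T X y"
      unfolding T no by simp
    moreover have "\<bar>T X y\<bar> \<le> real (N (insert x X) y)"
    proof (cases "X = {}")
      case True
      have "{A. A \<subseteq> X \<and> y < w x + sum w A \<and> w x + sum w A \<le> y + z} = {{}}"
        using False insert.prems[of x] True by auto
      then have "N (insert x X) y \<ge> 1"
        unfolding N by simp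
      moreover have "{A. A \<subseteq> X \<and> sum w A \<le> y} = {{}}"
        using True by auto
      ultimately show ?thesis
        by (simp add: T_def)
    next
      case False
      then show ?thesis
        using IH[of y] unfolding N by simp
    qed
    ultimately show ?thesis
      by (simp add: T_def N_def)
  qed
qed

text \<open>The untruncated case, all weights being zero.\<close>
lemma sum_Pow_minus_1:
  assumes "finite X" "X \<noteq> {}"
  shows "(\<Sum>A | A \<subseteq> X. (- 1 :: real) ^ card A) = 0"
  using truncated_sieve[of X "\<lambda>_. 0" 0 0] assms by simp

section \<open>Alternating sums over sets of irreducibles\<close>

lemma bij_betw_monic_poly_of:
  "bij_betw (monic_poly_of n) (PiE {..<n} D)
     {f. degree f = n \<and> lead_coeff f = 1 \<and> (\<forall>i<n. coeff f i \<in> D i)}"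
proof (rule bij_betw_byWitness[where f' = "\<lambda>f. \<lambda>i\<in>{..<n}. coeff f i"])
  show "\<forall>a\<in>PiE {..<n} D. (\<lambda>i\<in>{..<n}. coeff (monic_poly_of n a) i) = a"
    by (auto simp: coeff_monic_poly_of PiE_iff extensional_def fun_eq_iff)
  show "\<forall>f\<in>{f. degree f = n \<and> lead_coeff f = 1 \<and> (\<forall>i<n. coeff f i \<in> D i)}.
          monic_poly_of n (\<lambda>i\<in>{..<n}. coeff f i) = f"
    by (auto simp: poly_eq_iff coeff_monic_poly_of coeff_eq_0)
  show "monic_poly_of n ` PiE {..<n} D \<subseteq> {f. degree f = n \<and> lead_coeff f = 1 \<and> (\<forall>i<n. coeff f i \<in> D i)}"
    using degree_monic_poly_of lead_coeff_monic_poly_of by (auto simp: coeff_monic_poly_of PiE_iff)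
  show "(\<lambda>f. \<lambda>i\<in>{..<n}. coeff f i) ` {f. degree f = n \<and> lead_coeff f = 1 \<and> (\<forall>i<n. coeff f i \<in> D i)}
          \<subseteq> PiE {..<n} D"
    by (intro image_subsetI) (simp add: restrict_PiE_iff)
qed

context finite_subfield
begin

lemma Kmonic_degree_eq:
  "{f \<in> Kmonic. degree f = n} = {f. degree f = n \<and> lead_coeff f = 1 \<and> (\<forall>i<n. coeff f i \<in> K)}"
proof (intro Collect_cong iffI)
  fix f :: "'a poly"
  assume f: "degree f = n \<and> lead_coeff f = 1 \<and> (\<forall>i<n. coeff f i \<in> K)"
  have "coeff f i \<in> K" for i
    using f by (cases i n rule: linorder_cases) (auto simp: coeff_eq_0)
  then show "f \<in> Kmonic \<and> degree f = n"
    using f by (auto simp: Kmonic_def KX_def)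
qed (auto simp: Kmonic_def KX_def)

lemma card_Kmonic_degree: "card {f \<in> Kmonic. degree f = n} = card K ^ n"
  using bij_betw_same_card[OF bij_betw_monic_poly_of[of n "\<lambda>_. K"]]
  by (simp add: Kmonic_degree_eq card_PiE)

lemma finite_Kmonic_degree: "finite {f \<in> Kmonic. degree f = n}"
  using card_Kmonic_degree[of n] card_K_ge_2 by (intro card_ge_0_finite) simp

lemma finite_Kmonic_degree_le: "finite {f \<in> Kmonic. degree f \<le> n}"
proof -
  have "{f \<in> Kmonic. degree f \<le> n} = (\<Union>i\<le>n. {f \<in> Kmonic. degree f = i})"
    by auto
  then show ?thesis
    using finite_Kmonic_degree by simp
qed

text \<open>
  The irreducible \<open>t\<close> has to be excluded from the sieve, because equidistribution fails modulo \<open>t\<close>: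
  the constant coefficient is confined to a single coefficient set.  The suffix \<open>0\<close> marks polynomials
  with nonzero constant coefficient.
\<close>
definition Kmonic0 :: "nat \<Rightarrow> 'a poly set" where
  "Kmonic0 n = {f \<in> Kmonic. degree f = n \<and> coeff f 0 \<noteq> 0}"

lemma finite_Kmonic0: "finite (Kmonic0 n)"
  by (rule finite_subset[OF _ finite_Kmonic_degree[of n]]) (auto simp: Kmonic0_def)

lemma card_Kmonic0_0: "card (Kmonic0 0) = 1"
proof -
  have "Kmonic0 0 = {1}"
    using Kmonic_degree_0 by (auto simp: Kmonic0_def)
  then show ?thesis by simp
qed

lemma card_Kmonic0_Suc: "card (Kmonic0 (Suc n)) = (card K - 1) * card K ^ n"
proof -
  let ?D = "\<lambda>i. if i = 0 then K - {0} else K"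
  have "Kmonic0 (Suc n) = {f \<in> {f \<in> Kmonic. degree f = Suc n}. coeff f 0 \<noteq> 0}"
    by (auto simp: Kmonic0_def)
  also have "\<dots> = {f. degree f = Suc n \<and> lead_coeff f = 1 \<and> (\<forall>i<Suc n. coeff f i \<in> ?D i)}"
    unfolding Kmonic_degree_eq by auto
  finally have "card (Kmonic0 (Suc n)) = card (PiE {..<Suc n} ?D)"
    using bij_betw_same_card[OF bij_betw_monic_poly_of[of "Suc n" ?D]] by simp
  also have "\<dots> = (\<Prod>i<Suc n. card (?D i))"
    by (simp add: card_PiE)
  also have "\<dots> = (card K - 1) * card K ^ n"
    by (subst prod.lessThan_Suc_shift) (simp add: card_Diff_singleton)
  finally show ?thesis .
qed

definition Kirr0 :: "'a poly set" where
  "Kirr0 = {\<pi> \<in> Kirr. coeff \<pi> 0 \<noteq> 0}"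

text \<open>
  A finite set of irreducibles stands for the squarefree polynomial that is its product.
\<close>
definition irr_sets :: "nat \<Rightarrow> 'a poly set set" where
  "irr_sets n = {A. finite A \<and> A \<subseteq> Kirr0 \<and> (\<Sum>\<pi>\<in>A. degree \<pi>) \<le> n}"

lemma Kirr0_subset: "Kirr0 \<subseteq> Kirr"
  by (auto simp: Kirr0_def)

lemma finite_Kirr_degree_le: "finite {\<pi> \<in> Kirr. degree \<pi> \<le> n}"
  by (rule finite_subset[OF _ finite_Kmonic_degree_le[of n]]) (auto simp: KirrD)

lemma finite_irr_sets: "finite (irr_sets n)"
proof (rule finite_subset)
  show "irr_sets n \<subseteq> Pow {\<pi> \<in> Kirr. degree \<pi> \<le> n}"
  proof
    fix A assume A: "A \<in> irr_sets n"
    have "degree \<pi> \<le> n" if "\<pi> \<in> A" for \<pi>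
      using member_le_sum[of \<pi> A degree] A that by (auto simp: irr_sets_def)
    then show "A \<in> Pow {\<pi> \<in> Kirr. degree \<pi> \<le> n}"
      using A Kirr0_subset by (auto simp: irr_sets_def)
  qed
qed (simp add: finite_Kirr_degree_le)

lemma degree_Prod_irr:
  assumes "A \<subseteq> Kirr"
  shows "degree (\<Prod>A) = (\<Sum>\<pi>\<in>A. degree \<pi>)"
  using assms KirrD(3) by (intro degree_prod_eq_sum_degree) auto

lemma coeff_0_Prod_irr0:
  assumes "A \<subseteq> Kirr0"
  shows "coeff (\<Prod>A) 0 \<noteq> 0"
proof -
  have "coeff (\<Prod>A) 0 = (\<Prod>\<pi>\<in>A. coeff \<pi> 0)"
    by (simp add: poly_prod flip: poly_0_coeff_0)
  also have "\<dots> \<noteq> 0"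
  proof (cases "finite A")
    case True
    then show ?thesis
      using assms by (auto simp: Kirr0_def)
  qed simp
  finally show ?thesis .
qed

lemma irr_setsD:
  assumes "A \<in> irr_sets n"
  shows "finite A" "A \<subseteq> Kirr" "\<Prod>A \<in> Kmonic" "coeff (\<Prod>A) 0 \<noteq> 0" "degree (\<Prod>A) \<le> n"
    "degree (\<Prod>A) = (\<Sum>\<pi>\<in>A. degree \<pi>)"
proof -
  show *: "finite A" "A \<subseteq> Kirr"
    using assms Kirr0_subset by (auto simp: irr_sets_def)
  show "\<Prod>A \<in> Kmonic" "degree (\<Prod>A) = (\<Sum>\<pi>\<in>A. degree \<pi>)"
    using * Kmonic_Prod degree_Prod_irr by auto
  then show "degree (\<Prod>A) \<le> n" "coeff (\<Prod>A) 0 \<noteq> 0"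
    using assms coeff_0_Prod_irr0 by (auto simp: irr_sets_def)
qed

lemma card_irr_sets_degree: "card {A \<in> irr_sets n. degree (\<Prod>A) = j} \<le> card K ^ j"
proof -
  have "inj_on (\<lambda>A. \<Prod>A) {A \<in> irr_sets n. degree (\<Prod>A) = j}"
  proof (rule inj_on_inverseI[where g = "\<lambda>f. {\<pi> \<in> Kirr. \<pi> dvd f}"])
    fix A assume "A \<in> {A \<in> irr_sets n. degree (\<Prod>A) = j}"
    then have A: "finite A" "A \<subseteq> Kirr"
      using irr_setsD(1,2)[of A n] by simp_all
    then show "{\<pi> \<in> Kirr. \<pi> dvd \<Prod>A} = A"
      using Kirr_dvd_prod by (auto intro: dvd_prodI)
  qed
  then have "card {A \<in> irr_sets n. degree (\<Prod>A) = j} \<le> card {f \<in> Kmonic. degree f = j}"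
    using irr_setsD by (intro card_inj_on_le[of "\<lambda>A. \<Prod>A"] finite_Kmonic_degree) auto
  then show ?thesis
    by (simp add: card_Kmonic_degree)
qed

text \<open>
  The sum of the Moebius function of \<open>K[X]\<close> over the monic polynomials of degree \<open>j\<close> that are
  prime to \<open>t\<close>.
\<close>
definition mobius_sum :: "nat \<Rightarrow> real" where
  "mobius_sum j = (\<Sum>A | A \<in> irr_sets j \<and> degree (\<Prod>A) = j. (- 1) ^ card A)"

lemma irr_sets_degree_eq:
  assumes "j \<le> n"
  shows "{A \<in> irr_sets n. degree (\<Prod>A) = j} = {A. A \<in> irr_sets j \<and> degree (\<Prod>A) = j}"
  using assms irr_setsD(6) by (auto simp: irr_sets_def)

lemma sum_irr_sets:
  "(\<Sum>A\<in>irr_sets n. (- 1) ^ card A * h (degree (\<Prod>A))) = (\<Sum>j\<le>n. mobius_sum j * h j)"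
proof -
  have "(\<Sum>A\<in>irr_sets n. (- 1) ^ card A * h (degree (\<Prod>A))) =
        (\<Sum>j\<le>n. \<Sum>A | A \<in> irr_sets n \<and> degree (\<Prod>A) = j. (- 1) ^ card A * h (degree (\<Prod>A)))"
    using irr_setsD(5) by (intro sum.group[symmetric] finite_irr_sets) auto
  also have "\<dots> = (\<Sum>j\<le>n. mobius_sum j * h j)"
  proof (rule sum.cong[OF refl])
    fix j assume "j \<in> {..n}"
    then show "(\<Sum>A | A \<in> irr_sets n \<and> degree (\<Prod>A) = j. (- 1) ^ card A * h (degree (\<Prod>A))) =
                 mobius_sum j * h j"
      unfolding mobius_sum_def sum_distrib_right by (intro sum.cong irr_sets_degree_eq) auto
  qed
  finally show ?thesis .
qed

lemma mobius_sum_0: "mobius_sum 0 = 1"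
proof -
  have "{A. A \<in> irr_sets 0 \<and> degree (\<Prod>A) = 0} = {{}}"
    using KirrD(5) irr_setsD(2) by (fastforce simp: irr_sets_def)
  then show ?thesis
    by (simp add: mobius_sum_def)
qed

text \<open>
  The left side counts pairs of an \<open>f\<close> in \<open>Kmonic0 n\<close> and a set of irreducible divisors of \<open>f\<close>, with
  sign.  For fixed \<open>f \<noteq> 1\<close> the signs cancel.
\<close>
lemma mobius_inversion:
  assumes "n \<ge> 1"
  shows "(\<Sum>j\<le>n. mobius_sum j * real (card (Kmonic0 (n - j)))) = 0"
proof -
  have "(\<Sum>j\<le>n. mobius_sum j * real (card (Kmonic0 (n - j)))) =
        (\<Sum>A\<in>irr_sets n. (- 1) ^ card A * real (card (Kmonic0 (n - degree (\<Prod>A)))))"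
    by (rule sum_irr_sets[symmetric])
  also have "\<dots> = (\<Sum>A\<in>irr_sets n. (- 1) ^ card A * real (card {f \<in> Kmonic0 n. \<Prod>A dvd f}))"
  proof (intro sum.cong refl)
    fix A assume A: "A \<in> irr_sets n"
    let ?P = "\<Prod>A"
    have "bij_betw (\<lambda>h. ?P * h) (Kmonic0 (n - degree ?P)) {f \<in> Kmonic0 n. ?P dvd f}"
    proof (rule bij_betw_imageI)
      show "inj_on (\<lambda>h. ?P * h) (Kmonic0 (n - degree ?P))"
        using KmonicD(3)[OF irr_setsD(3)[OF A]] by (intro inj_onI) simp
      show "(\<lambda>h. ?P * h) ` Kmonic0 (n - degree ?P) = {f \<in> Kmonic0 n. ?P dvd f}"
      proof (intro equalityI subsetI)
        fix f assume "f \<in> (\<lambda>h. ?P * h) ` Kmonic0 (n - degree ?P)"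
        then obtain h where h: "f = ?P * h" "h \<in> Kmonic0 (n - degree ?P)"
          by auto
        then show "f \<in> {f \<in> Kmonic0 n. ?P dvd f}"
          using irr_setsD[OF A] KmonicD(3)
          by (auto simp: Kmonic0_def degree_mult_eq coeff_mult_0)
      next
        fix f assume "f \<in> {f \<in> Kmonic0 n. ?P dvd f}"
        then obtain h where h: "f = ?P * h" "f \<in> Kmonic0 n"
          by auto
        then have "h \<in> Kmonic"
          using Kmonic_cofactor irr_setsD(3)[OF A] by (auto simp: Kmonic0_def)
        then have "h \<in> Kmonic0 (n - degree ?P)"
          using h irr_setsD[OF A] KmonicD(3)
          by (auto simp: Kmonic0_def degree_mult_eq coeff_mult_0)
        then show "f \<in> (\<lambda>h. ?P * h) ` Kmonic0 (n - degree ?P)"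
          using h by auto
      qed
    qed
    then show "(- 1) ^ card A * real (card (Kmonic0 (n - degree ?P))) =
               (- 1) ^ card A * real (card {f \<in> Kmonic0 n. ?P dvd f})"
      by (simp add: bij_betw_same_card)
  qed
  also have "\<dots> = (\<Sum>A\<in>irr_sets n. \<Sum>f\<in>Kmonic0 n. if \<Prod>A dvd f then (- 1) ^ card A else 0)"
    using finite_Kmonic0 by (intro sum.cong refl) (simp add: sum.inter_filter[symmetric] mult.commute)
  also have "\<dots> = (\<Sum>f\<in>Kmonic0 n. \<Sum>A\<in>irr_sets n. if \<Prod>A dvd f then (- 1) ^ card A else 0)"
    by (rule sum.swap)
  also have "\<dots> = 0"
  proof (rule sum.neutral, rule ballI)
    fix f assume f: "f \<in> Kmonic0 n"
    define X where "X = {\<pi> \<in> Kirr0. \<pi> dvd f}"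
    have fK: "f \<in> Kmonic" "f \<noteq> 0" "degree f = n" "coeff f 0 \<noteq> 0"
      using f KmonicD(3) by (auto simp: Kmonic0_def)
    have "X \<subseteq> {\<pi> \<in> Kirr. degree \<pi> \<le> n}"
      using fK Kirr0_subset by (auto simp: X_def intro: dvd_imp_degree_le)
    then have finX: "finite X"
      using finite_Kirr_degree_le finite_subset by blast
    have "f \<noteq> 1"
      using fK assms by auto
    then obtain \<pi> where \<pi>: "\<pi> \<in> Kirr" "\<pi> dvd f"
      using ex_Kirr_dvd fK by blast
    then have "coeff \<pi> 0 \<noteq> 0"
      using fK by (auto simp: coeff_mult_0)
    then have "X \<noteq> {}"
      using \<pi> by (auto simp: X_def Kirr0_def)
    have "{A \<in> irr_sets n. \<Prod>A dvd f} = {A. A \<subseteq> X}"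
    proof (intro equalityI subsetI)
      fix A assume "A \<in> {A \<in> irr_sets n. \<Prod>A dvd f}"
      then have "A \<in> irr_sets n" "\<forall>\<pi>\<in>A. \<pi> dvd f"
        using Prod_power_dvd_iff[of A 1 f] irr_setsD by auto
      then show "A \<in> {A. A \<subseteq> X}"
        by (auto simp: X_def irr_sets_def)
    next
      fix A assume A: "A \<in> {A. A \<subseteq> X}"
      then have "finite A"
        using finX finite_subset by blast
      moreover have AK: "A \<subseteq> Kirr0" "A \<subseteq> Kirr"
        using A Kirr0_subset by (auto simp: X_def)
      ultimately have dvd: "\<Prod>A dvd f"
        using Prod_power_dvd_iff[of A 1 f] A by (auto simp: X_def)
      then have "degree (\<Prod>A) \<le> n"
        using fK dvd_imp_degree_le by blast
      then show "A \<in> {A \<in> irr_sets n. \<Prod>A dvd f}"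
        using dvd AK degree_Prod_irr[OF AK(2)] \<open>finite A\<close> by (simp add: irr_sets_def)
    qed
    then have "(\<Sum>A\<in>irr_sets n. if \<Prod>A dvd f then (- 1 :: real) ^ card A else 0) = (\<Sum>A | A \<subseteq> X. (- 1) ^ card A)"
      using finite_irr_sets by (simp add: sum.inter_filter[symmetric])
    then show "(\<Sum>A\<in>irr_sets n. if \<Prod>A dvd f then (- 1 :: real) ^ card A else 0) = 0"
      using sum_Pow_minus_1[OF finX \<open>X \<noteq> {}\<close>] by simp
  qed
  finally show ?thesis .
qed

text \<open>
  By \<open>mobius_inversion\<close>, the generating function of \<open>mobius_sum\<close> is the inverse of that of the
  cardinalities of \<open>Kmonic0\<close>, which is \<open>(1 - u) / (1 - Q u)\<close> with \<open>Q = card K\<close>; so it equals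
  \<open>(1 - Q u) / (1 - u) = 1 + (1 - Q) (u + u\<^sup>2 + \<dots>)\<close>.
\<close>
lemma mobius_sum_Suc: "mobius_sum (Suc n) = 1 - real (card K)"
proof -
  define G where "G = (\<lambda>n. \<Sum>j\<le>n. mobius_sum j * real (card K) ^ (n - j))"
  have Q: "real (card K - Suc 0) = real (card K) - 1"
    using card_K_ge_2 by simp
  have rec: "mobius_sum (Suc n) = - (real (card K) - 1) * G n" for n
  proof -
    have "0 = (\<Sum>j\<le>n. mobius_sum j * real (card (Kmonic0 (Suc (n - j))))) + mobius_sum (Suc n)"
      using mobius_inversion[of "Suc n"] by (simp add: card_Kmonic0_0 Suc_diff_le)
    also have "(\<Sum>j\<le>n. mobius_sum j * real (card (Kmonic0 (Suc (n - j))))) = (real (card K) - 1) * G n"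
      by (simp add: card_Kmonic0_Suc G_def sum_distrib_left Q mult_ac)
    finally show ?thesis
      by (simp add: algebra_simps)
  qed
  have "G n = 1" for n
  proof (induction n)
    case 0
    then show ?case by (simp add: G_def mobius_sum_0)
  next
    case (Suc n)
    have "G (Suc n) = real (card K) * G n + mobius_sum (Suc n)"
      by (simp add: G_def sum_distrib_left Suc_diff_le mult_ac)
    then show ?case
      by (simp add: rec Suc)
  qed
  then show ?thesis
    by (simp add: rec)
qed

text \<open>
  The limit \<open>Q / (Q + 1)\<close> for \<open>m \<rightarrow> \<infinity>\<close> is the Euler product of \<open>1 - Q^(- 2 degree \<pi>)\<close> over the
  irreducibles \<open>\<pi> \<noteq> t\<close>.
\<close>
lemma mobius_main_term:
  "(\<Sum>j\<le>m. mobius_sum j / real (card K) ^ (2 * j)) =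
     real (card K) / (real (card K) + 1) + 1 / ((real (card K) + 1) * real (card K) ^ (2 * m))"
proof (induction m)
  case 0
  then show ?case
    by (simp add: mobius_sum_0 field_simps)
next
  case (Suc m)
  define q where "q = real (card K)"
  define x where "x = q ^ (2 * m)"
  have q: "q > 0"
    using card_K_ge_2 by (simp add: q_def)
  then have x: "x > 0"
    by (simp add: x_def)
  have "1 / ((q + 1) * x) + (1 - q) / (q * q * x) = 1 / ((q + 1) * (q * q * x))"
    using q x by (simp add: divide_simps) (simp add: algebra_simps)
  then show ?case
    using Suc by (simp add: mobius_sum_Suc x_def mult.assoc flip: q_def)
qed

end

section \<open>Small irreducibles\<close>

lemma sum_power_le:
  assumes "(q :: real) \<ge> 2"
  shows "(\<Sum>j\<le>k. q ^ j) \<le> q ^ Suc k"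
proof (induction k)
  case (Suc k)
  have "(\<Sum>j\<le>Suc k. q ^ j) \<le> 2 * q ^ Suc k"
    using Suc by simp
  also have "\<dots> \<le> q * q ^ Suc k"
    using assms by (intro mult_right_mono) auto
  finally show ?case by simp
qed (use assms in auto)

lemma sum_inverse_power_le:
  assumes "(q :: real) \<ge> 2"
  shows "(\<Sum>j\<in>{m<..m+k}. 1 / q ^ j) \<le> 1 / q ^ m - 1 / q ^ (m + k)"
proof (induction k)
  case (Suc k)
  have "{m<..m + Suc k} = insert (m + Suc k) {m<..m + k}"
    by auto
  moreover have "2 / q ^ (m + Suc k) \<le> 1 / q ^ (m + k)"
    using assms by (simp add: field_simps)
  ultimately show ?case
    using Suc by simp
qed simp

context subfield_character
begin

text \<open>
  The truncated sieve is applied to each \<open>f\<close> with \<open>X\<close> the set of small irreducibles whose squares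
  divide \<open>f\<close>, weighted by degree.  After summation over all \<open>f\<close>, both the sieve sum and its error
  only involve the number of \<open>f\<close> divisible by a square of degree at most \<open>4 m\<close>, for which
  equidistribution holds.  The first \<open>l\<close> coefficient sets are arbitrary, so that the case of
  vanishing lowest coefficients is covered as well.
\<close>
lemma small_irreducibles_sieve:
  fixes D :: "nat \<Rightarrow> 'a set" and n l m :: nat
  assumes D: "\<And>i. i < n \<Longrightarrow> D i \<subseteq> K"
    and \<rho>: "0 < \<rho>" "\<rho> < 1"
    and decay: "\<And>i c. l \<le> i \<Longrightarrow> i < n \<Longrightarrow> c \<in> K - {0} \<Longrightarrow>
                  cmod (\<Sum>a\<in>D i. \<psi> (a * c)) \<le> \<rho> * real (card (D i))"
  defines "W \<equiv> real (\<Prod>i<n. card (D i))" and "Q \<equiv> real (card K)"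
  defines "V \<equiv> {a \<in> PiE {..<n} D. \<forall>\<pi>\<in>Kirr0. degree \<pi> \<le> m \<longrightarrow> \<not> \<pi> ^ 2 dvd monic_poly_of n a}"
  shows "\<bar>real (card V) - W * (Q / (Q + 1))\<bar>
           \<le> W * (2 / Q ^ m + Q ^ (2 * m + 1) * \<rho> ^ ((n - l) div (4 * m)))"
proof -
  define P where "P = PiE {..<n} D"
  define \<epsilon> where "\<epsilon> = \<rho> ^ ((n - l) div (4 * m))"
  define X where "X = (\<lambda>a. {\<pi> \<in> Kirr0. degree \<pi> \<le> m \<and> \<pi> ^ 2 dvd monic_poly_of n a})"
  define N where "N = (\<lambda>A. card {a \<in> P. (\<Prod>A) ^ 2 dvd monic_poly_of n a})"
  define h where "h = (\<lambda>A :: 'a poly set. degree (\<Prod>A))"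
  define U where "U = {A \<in> irr_sets (2 * m). m < h A}"
  have Q2: "Q \<ge> 2"
    using card_K_ge_2 by (simp add: Q_def)
  have W0: "W \<ge> 0"
    by (simp add: W_def prod_nonneg)
  have finP: "finite P"
    unfolding P_def by (intro finite_PiE) auto
  have cardP: "real (card P) = W"
    by (simp add: P_def W_def card_PiE)
  have finX: "finite (X a)" for a
    by (rule finite_subset[OF _ finite_Kirr_degree_le[of m]]) (use Kirr0_subset in \<open>auto simp: X_def\<close>)
  have \<epsilon>0: "\<epsilon> \<ge> 0"
    using \<rho> by (simp add: \<epsilon>_def)
  have split: "irr_sets (2 * m) = irr_sets m \<union> U" "irr_sets m \<inter> U = {}"
    using irr_setsD(5,6) unfolding U_def h_def by (auto simp: irr_sets_def)
  have N: "\<bar>real (N A) - W / Q ^ (2 * h A)\<bar> \<le> W * \<epsilon>" if A: "A \<in> irr_sets (2 * m)" for A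
  proof (cases "h A = 0")
    case True
    then have "\<Prod>A = 1"
      using irr_setsD(3)[OF A] Kmonic_degree_0 by (simp add: h_def)
    then show ?thesis
      using True W0 \<epsilon>0 by (simp add: N_def cardP)
  next
    case False
    have deg: "degree ((\<Prod>A) ^ 2) = 2 * h A"
      using KmonicD(3)[OF irr_setsD(3)[OF A]] by (simp add: degree_power_eq h_def)
    have "(\<Prod>A) ^ 2 \<in> Kmonic" "coeff ((\<Prod>A) ^ 2) 0 \<noteq> 0"
      using irr_setsD(3,4)[OF A] by (auto simp: power2_eq_square coeff_mult_0)
    then have "\<bar>real (N A) - W / Q ^ degree ((\<Prod>A) ^ 2)\<bar> \<le> W * \<rho> ^ ((n - l) div degree ((\<Prod>A) ^ 2))"
      unfolding N_def W_def Q_def P_def by (intro equidistribution D \<rho> decay)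
    then have "\<bar>real (N A) - W / Q ^ (2 * h A)\<bar> \<le> W * \<rho> ^ ((n - l) div (2 * h A))"
      unfolding deg .
    also have "\<dots> \<le> W * \<epsilon>"
    proof -
      have "h A \<le> 2 * m"
        using irr_setsD(5)[OF A] by (simp add: h_def)
      then have "(n - l) div (4 * m) \<le> (n - l) div (2 * h A)"
        using False by (intro div_le_mono2) auto
      then show ?thesis
        unfolding \<epsilon>_def using \<rho> W0 by (intro mult_left_mono power_decreasing) auto
    qed
    finally show ?thesis .
  qed
  have main: "\<bar>(\<Sum>A\<in>irr_sets m. (- 1) ^ card A * (W / Q ^ (2 * h A))) - W * (Q / (Q + 1))\<bar> \<le> W / Q ^ m"
  proof -
    have "(\<Sum>A\<in>irr_sets m. (- 1) ^ card A * (W / Q ^ (2 * h A))) = (\<Sum>j\<le>m. mobius_sum j * (W / Q ^ (2 * j)))"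
      unfolding h_def by (rule sum_irr_sets)
    also have "\<dots> = W * (\<Sum>j\<le>m. mobius_sum j / Q ^ (2 * j))"
      by (simp add: sum_distrib_left mult_ac)
    also have "\<dots> = W * (Q / (Q + 1)) + W * (1 / ((Q + 1) * Q ^ (2 * m)))"
      unfolding Q_def mobius_main_term by (simp add: distrib_left)
    finally have "\<bar>(\<Sum>A\<in>irr_sets m. (- 1) ^ card A * (W / Q ^ (2 * h A))) - W * (Q / (Q + 1))\<bar> =
                    W * (1 / ((Q + 1) * Q ^ (2 * m)))"
      using W0 Q2 by simp
    also have "\<dots> \<le> W * (1 / (1 * Q ^ m))"
      using Q2 W0 by (intro mult_left_mono divide_left_mono mult_mono power_increasing) auto
    finally show ?thesis by simp
  qed
  have card_degree: "real (card {A \<in> irr_sets (2 * m). h A = j}) \<le> Q ^ j" for j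
    using of_nat_mono[OF card_irr_sets_degree[of "2 * m" j], where ?'a = real]
    by (simp add: Q_def h_def)
  have cardU: "real (card (irr_sets (2 * m))) \<le> Q ^ (2 * m + 1)"
  proof -
    have "real (card (irr_sets (2 * m))) = (\<Sum>j\<le>2*m. real (card {A \<in> irr_sets (2 * m). h A = j}))"
    proof -
      have "h ` irr_sets (2 * m) \<subseteq> {..2 * m}"
        using irr_setsD(5)[of _ "2 * m"] by (auto simp: h_def)
      from sum.group[OF finite_irr_sets _ this, of "\<lambda>_. 1 :: real"] show ?thesis
        by simp
    qed
    also have "\<dots> \<le> (\<Sum>j\<le>2*m. Q ^ j)"
      by (intro sum_mono card_degree)
    also have "\<dots> \<le> Q ^ (2 * m + 1)"
      using sum_power_le[OF Q2] by simp
    finally show ?thesis .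
  qed
  have sumU: "(\<Sum>A\<in>U. 1 / Q ^ (2 * h A)) \<le> 1 / Q ^ m"
  proof -
    have finU: "finite U"
      unfolding U_def using finite_irr_sets by simp
    have "(\<Sum>A\<in>U. 1 / Q ^ (2 * h A)) = (\<Sum>j\<in>{m<..m+m}. \<Sum>A | A \<in> U \<and> h A = j. 1 / Q ^ (2 * h A))"
      using irr_setsD(5)[of _ "2 * m"]
      by (intro sum.group[symmetric] finU) (auto simp: U_def h_def simp flip: mult_2)
    also have "\<dots> \<le> (\<Sum>j\<in>{m<..m+m}. 1 / Q ^ j)"
    proof (rule sum_mono)
      fix j assume j: "j \<in> {m<..m+m}"
      have "(\<Sum>A | A \<in> U \<and> h A = j. 1 / Q ^ (2 * h A)) = real (card {A \<in> U. h A = j}) / Q ^ (2 * j)"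
        by simp
      also have "card {A \<in> U. h A = j} \<le> card {A \<in> irr_sets (2 * m). degree (\<Prod>A) = j}"
        using finite_irr_sets by (intro card_mono) (auto simp: U_def h_def)
      then have "real (card {A \<in> U. h A = j}) \<le> Q ^ j"
        using card_degree[of j] unfolding h_def by linarith
      then have "real (card {A \<in> U. h A = j}) / Q ^ (2 * j) \<le> Q ^ j / Q ^ (2 * j)"
        using Q2 by (intro divide_right_mono) auto
      also have "\<dots> = 1 / Q ^ j"
        using Q2 by (simp add: mult_2 power_add)
      finally show "(\<Sum>A | A \<in> U \<and> h A = j. 1 / Q ^ (2 * h A)) \<le> 1 / Q ^ j" .
    qed
    also have "\<dots> \<le> 1 / Q ^ m - 1 / Q ^ (m + m)"
      by (rule sum_inverse_power_le[OF Q2])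
    also have "\<dots> \<le> 1 / Q ^ m"
      using Q2 by simp
    finally show ?thesis .
  qed
  have sieve: "\<bar>(\<Sum>A\<in>irr_sets m. (- 1) ^ card A * (if (\<Prod>A) ^ 2 dvd monic_poly_of n a then 1 else 0))
                  - (if a \<in> V then 1 else 0 :: real)\<bar>
                \<le> (\<Sum>A\<in>U. if (\<Prod>A) ^ 2 dvd monic_poly_of n a then 1 else 0)" if a: "a \<in> P" for a
  proof -
    have sub: "A \<subseteq> X a \<longleftrightarrow> (\<Prod>A) ^ 2 dvd monic_poly_of n a" if A: "A \<in> irr_sets m" for A
    proof -
      have "degree \<pi> \<le> m" if "\<pi> \<in> A" for \<pi>
        using member_le_sum[of \<pi> A degree] A that by (auto simp: irr_sets_def)
      moreover have "A \<subseteq> Kirr0"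
        using A by (simp add: irr_sets_def)
      ultimately show ?thesis
        using Prod_power_dvd_iff[of A 2] irr_setsD(1,2)[OF A] by (auto simp: X_def)
    qed
    have fin: "finite A" "A \<subseteq> Kirr0" if "A \<subseteq> X a" for A
      using that finite_subset[OF that finX] by (auto simp: X_def)
    have "(\<Sum>A\<in>irr_sets m. (- 1) ^ card A * (if (\<Prod>A) ^ 2 dvd monic_poly_of n a then 1 else 0)) =
          (\<Sum>A | A \<in> irr_sets m \<and> A \<subseteq> X a. (- 1 :: real) ^ card A)"
      using sub finite_irr_sets by (subst sum.inter_filter) (auto intro!: sum.cong)
    also have "{A. A \<in> irr_sets m \<and> A \<subseteq> X a} = {A. A \<subseteq> X a \<and> (\<Sum>\<pi>\<in>A. degree \<pi>) \<le> m}"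
      using fin by (auto simp: irr_sets_def)
    finally have 1: "(\<Sum>A\<in>irr_sets m. (- 1) ^ card A * (if (\<Prod>A) ^ 2 dvd monic_poly_of n a then 1 else 0)) =
       (\<Sum>A | A \<subseteq> X a \<and> (\<Sum>\<pi>\<in>A. degree \<pi>) \<le> m. (- 1 :: real) ^ card A)" .
    have 2: "(if a \<in> V then 1 else 0 :: real) = (if X a = {} then 1 else 0)"
      using a by (auto simp: V_def X_def P_def)
    have "card {A. A \<subseteq> X a \<and> m < (\<Sum>\<pi>\<in>A. degree \<pi>) \<and> (\<Sum>\<pi>\<in>A. degree \<pi>) \<le> m + m} \<le>
          card {A \<in> U. (\<Prod>A) ^ 2 dvd monic_poly_of n a}"
    proof (rule card_mono)
      show "finite {A \<in> U. (\<Prod>A) ^ 2 dvd monic_poly_of n a}"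
        unfolding U_def using finite_irr_sets by simp
      show "{A. A \<subseteq> X a \<and> m < (\<Sum>\<pi>\<in>A. degree \<pi>) \<and> (\<Sum>\<pi>\<in>A. degree \<pi>) \<le> m + m} \<subseteq>
              {A \<in> U. (\<Prod>A) ^ 2 dvd monic_poly_of n a}"
      proof safe
        fix A assume A: "A \<subseteq> X a" "m < (\<Sum>\<pi>\<in>A. degree \<pi>)" "(\<Sum>\<pi>\<in>A. degree \<pi>) \<le> m + m"
        have *: "A \<in> irr_sets (2 * m)"
          using fin[OF A(1)] A(3) by (simp add: irr_sets_def)
        then show "A \<in> U"
          using A(2) irr_setsD(6)[OF *] by (simp add: U_def h_def)
        show "(\<Prod>A) ^ 2 dvd monic_poly_of n a"
          using Prod_power_dvd_iff[of A 2] irr_setsD(1,2)[OF *] A(1) by (auto simp: X_def)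
      qed
    qed
    then have "real (card {A. A \<subseteq> X a \<and> m < (\<Sum>\<pi>\<in>A. degree \<pi>) \<and> (\<Sum>\<pi>\<in>A. degree \<pi>) \<le> m + m}) \<le>
          real (card {A \<in> U. (\<Prod>A) ^ 2 dvd monic_poly_of n a})"
      by (rule of_nat_mono)
    also have "real (card {A \<in> U. (\<Prod>A) ^ 2 dvd monic_poly_of n a}) =
                 (\<Sum>A\<in>U. if (\<Prod>A) ^ 2 dvd monic_poly_of n a then 1 else 0)"
      unfolding U_def using finite_irr_sets by (subst sum.inter_filter[symmetric]) auto
    finally have 3: "real (card {A. A \<subseteq> X a \<and> m < (\<Sum>\<pi>\<in>A. degree \<pi>) \<and> (\<Sum>\<pi>\<in>A. degree \<pi>) \<le> m + m}) \<le>
          (\<Sum>A\<in>U. if (\<Prod>A) ^ 2 dvd monic_poly_of n a then 1 else 0)" .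
    have "degree \<pi> \<le> m" if "\<pi> \<in> X a" for \<pi>
      using that by (simp add: X_def)
    from truncated_sieve[OF finX this, where y = m] 3 show ?thesis
      unfolding 1 2 by (rule order.trans)
  qed
  have NS: "real (N A) = (\<Sum>a\<in>P. if (\<Prod>A) ^ 2 dvd monic_poly_of n a then 1 else 0)" for A
    unfolding N_def using finP by (subst sum.inter_filter[symmetric]) auto
  have VS: "real (card V) = (\<Sum>a\<in>P. if a \<in> V then 1 else 0)"
  proof -
    have "{a \<in> P. a \<in> V} = V"
      by (auto simp: V_def P_def)
    then show ?thesis
      using finP by (subst sum.inter_filter[symmetric]) auto
  qed
  have "\<bar>(\<Sum>A\<in>irr_sets m. (- 1) ^ card A * real (N A)) - real (card V)\<bar> =
        \<bar>\<Sum>a\<in>P. (\<Sum>A\<in>irr_sets m. (- 1) ^ card A * (if (\<Prod>A) ^ 2 dvd monic_poly_of n a then 1 else 0))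
                  - (if a \<in> V then 1 else 0)\<bar>"
    unfolding NS VS sum_distrib_left by (subst sum.swap) (simp only: sum_subtractf)
  also have "\<dots> \<le> (\<Sum>a\<in>P. \<Sum>A\<in>U. if (\<Prod>A) ^ 2 dvd monic_poly_of n a then 1 else 0)"
    by (rule order.trans[OF sum_abs sum_mono[OF sieve]])
  also have "\<dots> = (\<Sum>A\<in>U. real (N A))"
    unfolding NS by (rule sum.swap)
  finally have step1: "\<bar>(\<Sum>A\<in>irr_sets m. (- 1) ^ card A * real (N A)) - real (card V)\<bar> \<le> (\<Sum>A\<in>U. real (N A))" .
  have step2: "\<bar>(\<Sum>A\<in>irr_sets m. (- 1) ^ card A * real (N A))
                  - (\<Sum>A\<in>irr_sets m. (- 1) ^ card A * (W / Q ^ (2 * h A)))\<bar>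
                \<le> real (card (irr_sets m)) * (W * \<epsilon>)"
  proof -
    have "\<bar>(\<Sum>A\<in>irr_sets m. (- 1) ^ card A * real (N A))
             - (\<Sum>A\<in>irr_sets m. (- 1) ^ card A * (W / Q ^ (2 * h A)))\<bar> =
          \<bar>\<Sum>A\<in>irr_sets m. (- 1) ^ card A * (real (N A) - W / Q ^ (2 * h A))\<bar>"
      by (simp only: sum_subtractf right_diff_distrib)
    also have "\<dots> \<le> (\<Sum>A\<in>irr_sets m. W * \<epsilon>)"
    proof (rule order.trans[OF sum_abs sum_mono])
      fix A assume "A \<in> irr_sets m"
      then have "A \<in> irr_sets (2 * m)"
        by (simp add: irr_sets_def)
      then show "\<bar>(- 1) ^ card A * (real (N A) - W / Q ^ (2 * h A))\<bar> \<le> W * \<epsilon>"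
        using N by (simp add: abs_mult)
    qed
    finally show ?thesis by simp
  qed
  have step3: "(\<Sum>A\<in>U. real (N A)) \<le> W / Q ^ m + real (card U) * (W * \<epsilon>)"
  proof -
    have "(\<Sum>A\<in>U. real (N A)) \<le> (\<Sum>A\<in>U. W * (1 / Q ^ (2 * h A)) + W * \<epsilon>)"
    proof (rule sum_mono)
      fix A assume "A \<in> U"
      then have "\<bar>real (N A) - W / Q ^ (2 * h A)\<bar> \<le> W * \<epsilon>"
        by (intro N) (simp add: U_def)
      then show "real (N A) \<le> W * (1 / Q ^ (2 * h A)) + W * \<epsilon>"
        by simp
    qed
    also have "\<dots> = W * (\<Sum>A\<in>U. 1 / Q ^ (2 * h A)) + real (card U) * (W * \<epsilon>)"
      by (simp add: sum.distrib sum_distrib_left)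
    also have "W * (\<Sum>A\<in>U. 1 / Q ^ (2 * h A)) \<le> W * (1 / Q ^ m)"
      using sumU W0 by (rule mult_left_mono)
    finally show ?thesis by simp
  qed
  have "card (irr_sets (2 * m)) = card (irr_sets m) + card U"
    unfolding split(1) by (rule card_Un_disjoint) (use split(2) finite_irr_sets in \<open>auto simp: U_def\<close>)
  then have "real (card (irr_sets m)) * (W * \<epsilon>) + real (card U) * (W * \<epsilon>) = real (card (irr_sets (2 * m))) * (W * \<epsilon>)"
    by (simp add: distrib_right)
  also have "\<dots> \<le> Q ^ (2 * m + 1) * (W * \<epsilon>)"
    using cardU W0 \<epsilon>0 by (intro mult_right_mono) auto
  finally have "\<bar>real (card V) - W * (Q / (Q + 1))\<bar> \<le> 2 * (W / Q ^ m) + Q ^ (2 * m + 1) * (W * \<epsilon>)"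
    using step1 step2 step3 main by linarith
  then show ?thesis
    unfolding \<epsilon>_def by (simp add: algebra_simps)
qed

end

section \<open>Large irreducibles\<close>

lemma card_le_by_fibers:
  assumes "finite A" "finite B" "f ` A \<subseteq> B" "\<And>b. b \<in> B \<Longrightarrow> card {a \<in> A. f a = b} \<le> c"
  shows "card A \<le> c * card B"
proof -
  have "card A = (\<Sum>b\<in>B. card {a \<in> A. f a = b})"
    using sum.group[OF assms(1-3), of "\<lambda>_. 1 :: nat"] by simp
  also have "\<dots> \<le> (\<Sum>b\<in>B. c)"
    by (intro sum_mono assms(4))
  finally show ?thesis by (simp add: mult.commute)
qed

context finite_subfield
begin

lemma card_Kirr_dvd_le_degree:
  assumes "f \<noteq> 0"
  shows "finite {\<pi> \<in> Kirr. \<pi> dvd f}" "card {\<pi> \<in> Kirr. \<pi> dvd f} \<le> degree f"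
proof -
  let ?A = "{\<pi> \<in> Kirr. \<pi> dvd f}"
  show fin: "finite ?A"
    by (rule finite_subset[OF _ finite_Kirr_degree_le[of "degree f"]])
       (use assms in \<open>auto intro: dvd_imp_degree_le\<close>)
  have "card ?A \<le> (\<Sum>\<pi>\<in>?A. degree \<pi>)"
    using sum_mono[of ?A "\<lambda>_. 1" degree] KirrD(5) by auto
  also have "\<dots> = degree (\<Prod>?A)"
    by (rule degree_Prod_irr[symmetric]) auto
  also have "\<dots> \<le> degree f"
    using Prod_power_dvd_iff[of ?A 1 f] fin assms by (intro dvd_imp_degree_le) auto
  finally show "card ?A \<le> degree f" .
qed

lemma dvd_pderiv_if_square_dvd:
  fixes \<pi> f :: "'a poly"
  assumes "\<pi> ^ 2 dvd f"
  shows "\<pi> dvd pderiv f"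
proof -
  obtain g where "f = \<pi> ^ 2 * g"
    using assms by (rule dvdE)
  then have "f = \<pi> * (\<pi> * g)"
    by (simp add: power2_eq_square mult.assoc)
  then show ?thesis
    by (simp add: pderiv_mult mult.assoc)
qed

text \<open>
  Fixing the coefficients of \<open>f\<close> outside the \<open>m + 1\<close> indices \<open>p i\<close> fixes \<open>f'\<close>, so if \<open>f' \<noteq> 0\<close> there are at
  most \<open>degree f' \<le> n\<close> candidates for \<open>\<pi>\<close>.  If two such \<open>f\<close> are divisible by the same \<open>\<pi>\<close>, then
  \<open>\<pi>\<close> divides their difference, which is a \<open>p\<close>-th power \<open>u^p\<close> with \<open>degree u \<le> m < degree \<pi>\<close>; so
  \<open>u = 0\<close>.  The case \<open>f' = 0\<close> contributes the extra \<open>1\<close>: it fixes the coefficients at the \<open>m + 1\<close>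
  indices \<open>p i + 1\<close>.
\<close>
lemma large_irreducibles_bound:
  fixes D :: "nat \<Rightarrow> 'a set"
  assumes D: "\<And>i. i < n \<Longrightarrow> D i \<subseteq> K" and card_D: "\<And>i. i < n \<Longrightarrow> card (D i) = d"
    and n: "CHAR('a) * m + 1 < n"
  shows "card {a \<in> PiE {..<n} D. \<exists>\<pi>\<in>Kirr. m < degree \<pi> \<and> \<pi> ^ 2 dvd monic_poly_of n a}
           \<le> (n + 1) * d ^ (n - (m + 1))"
proof -
  define p where "p = CHAR('a)"
  define P where "P = PiE {..<n} D"
  define f :: "(nat \<Rightarrow> 'a) \<Rightarrow> 'a poly" where "f = monic_poly_of n"
  have p2: "p \<ge> 2"
    unfolding p_def using CHAR_prime[where ?'a = 'a] prime_ge_2_nat by blast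
  have finP: "finite P"
    unfolding P_def by (intro finite_PiE) auto
  have PK: "a i \<in> K" if "a \<in> P" "i < n" for a i
    using that D[of i] by (auto simp: P_def PiE_iff)
  have coeff_f: "coeff (f a) i = a i" if "i < n" for a i
    using that by (simp add: f_def coeff_monic_poly_of)
  have n': "p * i < n" "p * i + 1 < n" if "i \<le> m" for i
  proof -
    have "p * i \<le> p * m"
      using that by simp
    then show "p * i < n" "p * i + 1 < n"
      using n unfolding p_def by linarith+
  qed
  have fibers: "card A \<le> c * d ^ (n - (m + 1))"
    if J: "J \<subseteq> {..<n}" "card J = m + 1" and A: "A \<subseteq> P"
      and fib: "\<And>b. card {a \<in> A. restrict a ({..<n} - J) = b} \<le> c" for A J c
  proof -
    have "card A \<le> c * card (PiE ({..<n} - J) D)"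
    proof (rule card_le_by_fibers[where f = "\<lambda>a. restrict a ({..<n} - J)"])
      show "(\<lambda>a. restrict a ({..<n} - J)) ` A \<subseteq> PiE ({..<n} - J) D"
        using A by (intro image_subsetI) (auto simp: restrict_PiE_iff P_def PiE_iff)
    qed (use A finP finite_subset fib in \<open>auto intro!: finite_PiE\<close>)
    also have "card (PiE ({..<n} - J) D) = (\<Prod>i\<in>{..<n}-J. d)"
      using card_D by (simp add: card_PiE)
    also have "\<dots> = d ^ (n - (m + 1))"
      using J by (simp add: card_Diff_subset finite_subset)
    finally show ?thesis .
  qed
  have agree: "a i = a' i" if "restrict a I = restrict a' I" "i \<in> I" for a a' :: "nat \<Rightarrow> 'a" and I i
    using that by (metis restrict_apply')

  \<comment> \<open>Vanishing derivative: the coefficient of \<open>t^(p i)\<close> in \<open>f'\<close> is that of \<open>t^(p i + 1)\<close> in \<open>f\<close>.\<close>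
  define A1 where "A1 = {a \<in> P. pderiv (f a) = 0}"
  have "card A1 \<le> 1 * d ^ (n - (m + 1))"
  proof (rule fibers)
    let ?J = "(\<lambda>i. p * i + 1) ` {..m}"
    show "?J \<subseteq> {..<n}"
      using n' by auto
    show "card ?J = m + 1"
      using p2 by (subst card_image) (auto intro!: inj_onI)
    show "A1 \<subseteq> P"
      by (auto simp: A1_def)
    fix b
    have zero: "a (p * i + 1) = 0" if "a \<in> A1" "i \<le> m" for a i
    proof -
      have "coeff (pderiv (f a)) (p * i) = a (p * i + 1)"
        using n'[OF that(2)] by (simp add: coeff_pderiv coeff_f p_def)
      then show ?thesis
        using that(1) by (simp add: A1_def)
    qed
    have "a = a'" if a: "a \<in> A1" "restrict a ({..<n} - ?J) = b" "a' \<in> A1" "restrict a' ({..<n} - ?J) = b" for a a'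
    proof (rule PiE_ext)
      show "a \<in> PiE {..<n} D" "a' \<in> PiE {..<n} D"
        using a by (auto simp: A1_def P_def)
    next
      fix i assume i: "i \<in> {..<n}"
      show "a i = a' i"
      proof (cases "i \<in> ?J")
        case True
        then obtain i' where "i = p * i' + 1" "i' \<le> m"
          by auto
        then show ?thesis
          using zero[OF a(1), of i'] zero[OF a(3), of i'] by simp
      next
        case False
        then show ?thesis
          using agree[of a "{..<n} - ?J" a' i] a i by auto
      qed
    qed
    then show "card {a \<in> A1. restrict a ({..<n} - ?J) = b} \<le> 1"
      using finP by (subst One_nat_def, subst card_le_Suc0_iff_eq) (auto simp: A1_def)
  qed
  moreover
  \<comment> \<open>Nonvanishing derivative: each fibre injects into the irreducible divisors of the common derivative.\<close>
  define A2 where "A2 = {a \<in> P. pderiv (f a) \<noteq> 0 \<and> (\<exists>\<pi>\<in>Kirr. m < degree \<pi> \<and> \<pi> ^ 2 dvd f a)}"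
  have "card A2 \<le> n * d ^ (n - (m + 1))"
  proof (rule fibers)
    let ?J = "(\<lambda>i. p * i) ` {..m}"
    show "?J \<subseteq> {..<n}"
      using n' by auto
    show "card ?J = m + 1"
      using p2 by (subst card_image) (auto intro!: inj_onI)
    show "A2 \<subseteq> P"
      by (auto simp: A2_def)
    fix b
    define B where "B = {a \<in> A2. restrict a ({..<n} - ?J) = b}"
    have same_deriv: "pderiv (f a) = pderiv (f a')" if "a \<in> B" "a' \<in> B" for a a'
    proof (rule poly_eqI)
      fix j
      show "coeff (pderiv (f a)) j = coeff (pderiv (f a')) j"
      proof (cases "p dvd Suc j")
        case True
        then have "(of_nat (Suc j) :: 'a) = 0"
          by (simp only: of_nat_eq_0_iff_char_dvd p_def)
        then show ?thesis
          by (simp only: coeff_pderiv mult_zero_left)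
      next
        case False
        have "coeff (f a) (Suc j) = coeff (f a') (Suc j)"
        proof (cases "Suc j < n")
          case True
          then have "Suc j \<in> {..<n} - ?J"
            using False by auto
          then show ?thesis
            using agree[of a "{..<n} - ?J" a' "Suc j"] that True by (simp add: B_def coeff_f)
        qed (simp add: f_def coeff_monic_poly_of)
        then show ?thesis
          by (simp only: coeff_pderiv)
      qed
    qed
    show "card {a \<in> A2. restrict a ({..<n} - ?J) = b} \<le> n"
    proof (cases "B = {}")
      case True
      then show ?thesis
        unfolding B_def by (simp only: card.empty)
    next
      case False
      then obtain a0 where a0: "a0 \<in> B" by auto
      define F where "F = pderiv (f a0)"
      have "F \<noteq> 0"
        using a0 by (simp add: F_def B_def A2_def)
      define \<pi> where "\<pi> = (\<lambda>a. SOME \<pi>. \<pi> \<in> Kirr \<and> m < degree \<pi> \<and> \<pi> ^ 2 dvd f a)"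
      have \<pi>: "\<pi> a \<in> Kirr" "m < degree (\<pi> a)" "\<pi> a ^ 2 dvd f a" if "a \<in> B" for a
      proof -
        have "\<exists>\<pi>. \<pi> \<in> Kirr \<and> m < degree \<pi> \<and> \<pi> ^ 2 dvd f a"
          using that by (auto simp: B_def A2_def)
        then have "\<pi> a \<in> Kirr \<and> m < degree (\<pi> a) \<and> \<pi> a ^ 2 dvd f a"
          unfolding \<pi>_def by (rule someI_ex)
        then show "\<pi> a \<in> Kirr" "m < degree (\<pi> a)" "\<pi> a ^ 2 dvd f a" by auto
      qed
      have "inj_on \<pi> B"
      proof (rule inj_onI)
        fix a a' assume a: "a \<in> B" "a' \<in> B" "\<pi> a = \<pi> a'"
        then have aP: "a \<in> P" "a' \<in> P"
          by (auto simp: B_def A2_def)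
        define c where "c = (\<lambda>i. a (p * i) - a' (p * i))"
        have "c i \<in> K" if "i \<le> m" for i
          unfolding c_def using aP n'[OF that] PK by auto
        then obtain u where u: "u \<in> KX" "degree u \<le> m" "u ^ p = (\<Sum>i\<le>m. monom (c i) (p * i))"
          using KX_pth_root[of m c] unfolding p_def by metis
        have coeff_u: "coeff (u ^ p) (p * i) = c i" if "i \<le> m" for i
        proof -
          have "coeff (u ^ p) (p * i) = (\<Sum>i'\<le>m. if i' = i then c i else 0)"
            unfolding u(3) coeff_sum using p2 by (intro sum.cong) auto
          then show ?thesis
            using that by simp
        qed
        have "u ^ p = f a - f a'"
        proof (rule poly_eqI)
          fix j
          show "coeff (u ^ p) j = coeff (f a - f a') j"
          proof (cases "j \<in> ?J")
            case True
            then obtain i where "j = p * i" "i \<le> m" by auto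
            then show ?thesis
              using coeff_u n' by (simp add: c_def coeff_f)
          next
            case False
            have "coeff (u ^ p) j = 0"
              unfolding u(3) coeff_sum using False by (intro sum.neutral) auto
            moreover have "coeff (f a) j = coeff (f a') j"
            proof (cases "j < n")
              case True
              then show ?thesis
                using False agree[of a "{..<n} - ?J" a' j] a by (simp add: B_def coeff_f)
            qed (simp add: f_def coeff_monic_poly_of)
            ultimately show ?thesis by simp
          qed
        qed
        moreover have "\<pi> a dvd f a" "\<pi> a dvd f a'"
          using \<pi>(3)[OF a(1)] \<pi>(3)[OF a(2)] a(3) by (auto simp: power2_eq_square dest: dvd_mult_left)
        ultimately have "\<pi> a dvd u ^ p"
          by simp
        then have "\<pi> a dvd u"
          using Kirr_dvd_power \<pi>(1)[OF a(1)] u(1) by blast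
        then have "u = 0"
          using \<pi>(2)[OF a(1)] u(2) dvd_imp_degree_le[of "\<pi> a" u] by fastforce
        then have "f a = f a'"
          using \<open>u ^ p = f a - f a'\<close> p2 by (simp add: power_0_left)
        then have "a i = a' i" if "i < n" for i
          using coeff_f[OF that] by metis
        then show "a = a'"
          using aP unfolding P_def by (intro PiE_ext[of a "{..<n}" D a']) auto
      qed
      moreover have "\<pi> ` B \<subseteq> {\<pi> \<in> Kirr. \<pi> dvd F}"
      proof (rule image_subsetI)
        fix a assume a: "a \<in> B"
        have "\<pi> a dvd pderiv (f a)"
          by (rule dvd_pderiv_if_square_dvd[OF \<pi>(3)[OF a]])
        then show "\<pi> a \<in> {\<pi> \<in> Kirr. \<pi> dvd F}"
          using \<pi>(1)[OF a] same_deriv[OF a a0] by (simp add: F_def)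
      qed
      ultimately have "card B \<le> card {\<pi> \<in> Kirr. \<pi> dvd F}"
        by (rule card_inj_on_le[OF _ _ card_Kirr_dvd_le_degree(1)[OF \<open>F \<noteq> 0\<close>]])
      also have "\<dots> \<le> degree F"
        by (rule card_Kirr_dvd_le_degree(2)[OF \<open>F \<noteq> 0\<close>])
      also have "\<dots> \<le> n"
        using degree_pderiv_le[of "f a0"] by (simp add: F_def f_def degree_monic_poly_of)
      finally show ?thesis
        unfolding B_def .
    qed
  qed
  ultimately have "card (A1 \<union> A2) \<le> (n + 1) * d ^ (n - (m + 1))"
    using card_Un_le[of A1 A2] by (simp add: algebra_simps)
  moreover have "card {a \<in> PiE {..<n} D. \<exists>\<pi>\<in>Kirr. m < degree \<pi> \<and> \<pi> ^ 2 dvd monic_poly_of n a} \<le> card (A1 \<union> A2)"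
  proof (rule card_mono)
    show "finite (A1 \<union> A2)"
      using finP by (simp add: A1_def A2_def)
  qed (auto simp: A1_def A2_def P_def f_def)
  ultimately show ?thesis
    by linarith
qed

end

section \<open>Counting squarefree polynomials with restricted coefficients\<close>

context finite_subfield
begin

lemma monom_1_1_Kirr: "monom 1 1 \<in> Kirr"
proof -
  have X: "monom 1 1 \<in> Kmonic"
    by (simp add: Kmonic_def degree_monom_eq)
  have "g = 1 \<or> g = monom 1 1" if g: "g \<in> Kmonic" "g dvd monom 1 1" for g
  proof -
    have "degree g \<le> 1"
      using dvd_imp_degree_le[OF g(2)] by (simp add: degree_monom_eq)
    then consider "degree g = 0" | "degree g = 1"
      by linarith
    then show ?thesis
    proof cases
      case 1
      then show ?thesis
        using Kmonic_degree_0 g by simp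
    next
      case 2
      then show ?thesis
        using Kmonic_dvd_degree_eq[OF g(1) X g(2)] by (simp add: degree_monom_eq)
    qed
  qed
  moreover have "monom 1 1 \<noteq> (1 :: 'a poly)"
    by (metis degree_1 degree_monom_eq zero_neq_one)
  ultimately show ?thesis
    using X by (auto simp: Kirr_def)
qed

lemma Kirr_cases:
  assumes "\<pi> \<in> Kirr"
  shows "\<pi> = monom 1 1 \<or> \<pi> \<in> Kirr0"
proof (cases "coeff \<pi> 0 = 0")
  case True
  then have "monom 1 1 dvd \<pi>"
    by (simp add: monom_1_dvd_iff')
  then show ?thesis
    using Kirr_dvd_Kirr[OF monom_1_1_Kirr assms] by auto
qed (use assms in \<open>auto simp: Kirr0_def\<close>)

lemma monom_square_dvd_iff:
  assumes "n \<ge> 2"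
  shows "monom 1 1 ^ 2 dvd monic_poly_of n a \<longleftrightarrow> a 0 = 0 \<and> a 1 = (0 :: 'a)"
proof -
  have "monom 1 1 ^ 2 = (monom 1 2 :: 'a poly)"
    by (simp add: monom_power)
  then show ?thesis
    using assms by (auto simp: monom_1_dvd_iff' coeff_monic_poly_of less_2_cases_iff)
qed

end

context subfield_character
begin

text \<open>
  Take the polynomials that survive the sieve by the small irreducibles other than \<open>t\<close>, and remove
  those divisible by \<open>t\<^sup>2\<close>.  What remains are the squarefree polynomials and some that are divisible
  by the square of a large irreducible.
\<close>
lemma restricted_squarefree_asymptotics:
  fixes R :: "nat \<Rightarrow> 'a set" and k p n s :: nat
  assumes R: "\<And>i. i < n \<Longrightarrow> R i \<subseteq> K" "\<And>i. i < n \<Longrightarrow> card (R i) = s"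
    and affine: "\<And>i. i < n \<Longrightarrow> \<not> (\<exists>A. proper_affine_subspace_of K A \<and> K - R i \<subseteq> A)"
    and \<rho>: "0 < \<rho>" "\<rho> < 1"
    and decay: "\<And>D c. cmod (\<Sum>a\<in>D. \<psi> (a * c)) < real (card D) \<Longrightarrow>
                  cmod (\<Sum>a\<in>D. \<psi> (a * c)) \<le> \<rho> * real (card D)"
    and n: "n \<ge> 2" and cardK: "card K = p ^ k"
  defines "W \<equiv> (real p ^ k - real s) ^ n"
  shows "real p ^ k - real s \<ge> 2"
    and "real (card (restricted_squarefree K R n)) \<le> W"
    and "kappa p k s R \<ge> 1 / 2"
    and "\<And>m. m \<ge> 1 \<Longrightarrow> CHAR('a) * m + 1 < n \<Longrightarrow>
           \<bar>real (card (restricted_squarefree K R n)) - kappa p k s R * W\<bar> \<le>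
             W * ((real n + 5) / 2 ^ m + 2 * real (card K) ^ (2 * m + 1) * \<rho> ^ ((n - 2) div (4 * m)))"
proof -
  define Q where "Q = real (card K)"
  define d where "d = card K - s"
  define D where "D = (\<lambda>i. K - R i)"
  define P where "P = PiE {..<n} D"
  define f :: "(nat \<Rightarrow> 'a) \<Rightarrow> 'a poly" where "f = monic_poly_of n"
  define S where "S = {a \<in> P. \<forall>\<pi>\<in>Kirr. \<not> \<pi> ^ 2 dvd f a}"
  have Q2: "Q \<ge> 2"
    using card_K_ge_2 by (simp add: Q_def)
  have DK: "D i \<subseteq> K" for i
    by (auto simp: D_def)
  have cardD: "card (D i) = d" if "i < n" for i
    using R[OF that] by (simp add: D_def d_def card_Diff_subset finite_subset)
  have less: "cmod (\<Sum>a\<in>D i. \<psi> (a * c)) < real (card (D i))" if "i < n" "c \<in> K - {0}" for i c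
  proof (rule character_sum_less[OF DK])
    show "\<not> (\<exists>A. proper_affine_subspace_of K A \<and> D i \<subseteq> A)"
      using affine[OF that(1)] by (simp add: D_def)
  qed (use that in auto)
  have "s \<le> card K"
    using R[of 0] n card_mono[of K "R 0"] by auto
  then have d_eq: "real d = real p ^ k - real s"
    using cardK by (simp add: d_def of_nat_diff flip: of_nat_power)
  have "d \<ge> 2"
  proof (rule ccontr)
    assume "\<not> d \<ge> 2"
    then have "card (D 0) = 0 \<or> card (D 0) = 1"
      using cardD[of 0] n by linarith
    moreover have "cmod (\<Sum>a\<in>D 0. \<psi> (a * 1)) < real (card (D 0))"
      using n by (intro less) auto
    ultimately show False
      by (auto simp: card_1_singleton_iff norm_\<psi>)
  qed
  then have d2: "real d \<ge> 2" by simp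
  then show "real p ^ k - real s \<ge> 2"
    by (simp add: d_eq)
  have W: "W = real d ^ n"
    by (simp add: W_def d_eq)
  have W0: "W \<ge> 0"
    by (simp add: W)
  have finP: "finite P"
    unfolding P_def by (intro finite_PiE) auto
  have cardP: "real (card P) = W"
    using cardD by (simp add: P_def card_PiE W)
  have fK: "f a \<in> Kmonic" if "a \<in> P" for a
    using that unfolding f_def P_def by (rule monic_poly_of_Kmonic) (rule DK)
  have bij: "bij_betw f P {g. degree g = n \<and> lead_coeff g = 1 \<and> (\<forall>i<n. coeff g i \<in> D i)}"
    unfolding f_def P_def by (rule bij_betw_monic_poly_of)
  have "restricted_squarefree K R n = {g \<in> f ` P. squarefree g}"
    unfolding bij_betw_imp_surj_on[OF bij] by (auto simp: restricted_squarefree_def D_def)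
  also have "\<dots> = f ` S"
    using squarefree_iff_Kirr[OF fK] by (auto simp: S_def)
  finally have "card (restricted_squarefree K R n) = card (f ` S)"
    by simp
  also have "\<dots> = card S"
    by (intro card_image inj_on_subset[OF bij_betw_imp_inj_on[OF bij]]) (auto simp: S_def)
  finally have card_S: "card (restricted_squarefree K R n) = card S" .
  have "card S \<le> card P"
    using finP by (intro card_mono) (auto simp: S_def)
  then show "real (card (restricted_squarefree K R n)) \<le> W"
    unfolding card_S using cardP by linarith
  have "1 / (1 + 1 / Q) = Q / (Q + 1)"
    using Q2 by (simp add: field_simps)
  moreover have "real p ^ k = Q"
    by (simp add: Q_def cardK)
  ultimately have kappa: "kappa p k s R =
      (if 0 \<in> R 0 \<or> 0 \<in> R 1 then Q / (Q + 1) else Q / (Q + 1) * (1 - 1 / real d ^ 2))"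
    unfolding kappa_def d_eq by simp
  have Q3: "Q / (Q + 1) \<ge> 2 / 3"
    using Q2 by (simp add: field_simps)
  have "1 / real d ^ 2 \<le> 1 / 2 ^ 2"
    using d2 by (intro divide_left_mono power_mono) auto
  then have d3: "1 - 1 / real d ^ 2 \<ge> 3 / 4"
    by simp
  have "Q / (Q + 1) * (1 - 1 / real d ^ 2) \<ge> 2 / 3 * (3 / 4)"
    using Q2 Q3 d3 by (intro mult_mono) auto
  then show "kappa p k s R \<ge> 1 / 2"
    using Q3 by (simp add: kappa)

  fix m :: nat
  assume m: "m \<ge> 1" and p: "CHAR('a) * m + 1 < n"
  define \<epsilon> where "\<epsilon> = 2 / Q ^ m + Q ^ (2 * m + 1) * \<rho> ^ ((n - 2) div (4 * m))"
  define V where "V = {a \<in> P. \<forall>\<pi>\<in>Kirr0. degree \<pi> \<le> m \<longrightarrow> \<not> \<pi> ^ 2 dvd f a}"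
  define B where "B = {a \<in> P. \<exists>\<pi>\<in>Kirr. m < degree \<pi> \<and> \<pi> ^ 2 dvd f a}"
  define Z where "Z = {a \<in> V. monom 1 1 ^ 2 dvd f a}"
  have \<epsilon>0: "\<epsilon> \<ge> 0"
    using Q2 \<rho> by (simp add: \<epsilon>_def)
  have fin: "finite S" "finite V" "finite B" "finite Z"
    using finP by (auto simp: S_def V_def B_def Z_def)
  have decayD: "cmod (\<Sum>a\<in>D i. \<psi> (a * c)) \<le> \<rho> * real (card (D i))" if "i < n" "c \<in> K - {0}" for i c
    by (rule decay[OF less[OF that]])
  have "\<bar>real (card V) - real (\<Prod>i<n. card (D i)) * (Q / (Q + 1))\<bar> \<le>
           real (\<Prod>i<n. card (D i)) * (2 / Q ^ m + Q ^ (2 * m + 1) * \<rho> ^ ((n - 0) div (4 * m)))"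
    unfolding V_def P_def f_def Q_def by (rule small_irreducibles_sieve[OF DK \<rho> decayD])
  also have "real (\<Prod>i<n. card (D i)) = W"
    using cardD by (simp add: W)
  also have "W * (2 / Q ^ m + Q ^ (2 * m + 1) * \<rho> ^ ((n - 0) div (4 * m))) \<le> W * \<epsilon>"
    unfolding \<epsilon>_def using W0 Q2 \<rho>
    by (intro mult_left_mono add_left_mono power_decreasing div_le_mono) auto
  finally have V: "\<bar>real (card V) - W * (Q / (Q + 1))\<bar> \<le> W * \<epsilon>" .
  have Z: "\<bar>real (card Z) - (if 0 \<in> R 0 \<or> 0 \<in> R 1 then 0 else W / real d ^ 2 * (Q / (Q + 1)))\<bar> \<le> W * \<epsilon>"
  proof (cases "0 \<in> R 0 \<or> 0 \<in> R 1")
    case True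
    have "\<not> monom 1 1 ^ 2 dvd f a" if "a \<in> P" for a
    proof -
      have "a 0 \<in> D 0" "a 1 \<in> D 1"
        using that n by (auto simp: P_def PiE_iff)
      then show ?thesis
        unfolding f_def monom_square_dvd_iff[OF n] using True by (auto simp: D_def)
    qed
    then have "Z = {}"
      by (auto simp: Z_def V_def)
    then show ?thesis
      using True W0 \<epsilon>0 by simp
  next
    case False
    \<comment> \<open>Divisibility by \<open>t\<^sup>2\<close> freezes the two lowest coefficients; equidistribution needs only the others.\<close>
    define D' where "D' = (\<lambda>i. if i < 2 then {0} else D i)"
    have in_PiE: "a \<in> PiE {..<n} D' \<longleftrightarrow> a \<in> P \<and> a 0 = 0 \<and> a 1 = 0" for a
    proof -
      have "0 \<in> D 0" "0 \<in> D 1"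
        using False by (auto simp: D_def)
      then have "a i \<in> D i" if "i < 2" "a i = 0" for i
        using that by (auto simp: less_2_cases_iff)
      then have "a i \<in> D' i \<longleftrightarrow> a i \<in> D i \<and> (i < 2 \<longrightarrow> a i = 0)" for i
        unfolding D'_def by (cases "i < 2") auto
      then have "(\<forall>i\<in>{..<n}. a i \<in> D' i) \<longleftrightarrow> (\<forall>i\<in>{..<n}. a i \<in> D i) \<and> (\<forall>i<2. a i = 0)"
        using n less_le_trans[of _ 2 n] by blast
      moreover have "(\<forall>i<2. a i = 0) \<longleftrightarrow> a 0 = 0 \<and> a 1 = 0"
        by (auto simp: less_2_cases_iff)
      ultimately show ?thesis
        unfolding P_def PiE_iff by blast
    qed
    have Z_eq: "Z = {a \<in> PiE {..<n} D'. \<forall>\<pi>\<in>Kirr0. degree \<pi> \<le> m \<longrightarrow> \<not> \<pi> ^ 2 dvd monic_poly_of n a}"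
      unfolding Z_def V_def f_def monom_square_dvd_iff[OF n] using in_PiE by auto
    have "D' i \<subseteq> K" for i
      using DK by (auto simp: D'_def)
    moreover have "cmod (\<Sum>a\<in>D' i. \<psi> (a * c)) \<le> \<rho> * real (card (D' i))"
      if "2 \<le> i" "i < n" "c \<in> K - {0}" for i c
      using decayD[OF that(2,3)] that(1) by (simp add: D'_def)
    ultimately have "\<bar>real (card Z) - real (\<Prod>i<n. card (D' i)) * (Q / (Q + 1))\<bar> \<le>
             real (\<Prod>i<n. card (D' i)) * \<epsilon>"
      unfolding Z_eq \<epsilon>_def Q_def by (intro small_irreducibles_sieve \<rho>) auto
    also have "real (\<Prod>i<n. card (D' i)) = W / real d ^ 2"
    proof -
      obtain n' where n': "n = Suc (Suc n')"
        using n by (metis add_2_eq_Suc le_Suc_ex)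
      have "(\<Prod>i<n. card (D' i)) = d ^ n'"
        using cardD unfolding n' prod.lessThan_Suc_shift by (simp add: D'_def)
      then show ?thesis
        using d2 by (simp add: W n' power2_eq_square)
    qed
    also have "W / real d ^ 2 * \<epsilon> \<le> W * \<epsilon>"
    proof -
      have "W / real d ^ 2 \<le> W / 1"
        using d2 W0 by (intro divide_left_mono) (auto simp: one_le_power)
      then show ?thesis
        using \<epsilon>0 by (intro mult_right_mono) auto
    qed
    finally show ?thesis
      using False by simp
  qed
  have main: "kappa p k s R * W =
      W * (Q / (Q + 1)) - (if 0 \<in> R 0 \<or> 0 \<in> R 1 then 0 else W / real d ^ 2 * (Q / (Q + 1)))"
    unfolding kappa by (simp add: algebra_simps)
  have "S \<subseteq> V - Z"
    using Kirr0_subset monom_1_1_Kirr by (auto simp: S_def V_def Z_def)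
  then have "card S \<le> card (V - Z)"
    using fin by (intro card_mono) auto
  moreover have "V - Z \<subseteq> S \<union> B"
  proof
    fix a assume a: "a \<in> V - Z"
    show "a \<in> S \<union> B"
    proof (rule ccontr)
      assume no: "a \<notin> S \<union> B"
      have aP: "a \<in> P"
        using a by (simp add: V_def)
      then obtain \<pi> where \<pi>: "\<pi> \<in> Kirr" "\<pi> ^ 2 dvd f a"
        using no by (auto simp: S_def)
      then have "degree \<pi> \<le> m"
        using no aP by (auto simp: B_def not_less)
      then show False
        using Kirr_cases[OF \<pi>(1)] \<pi>(2) a by (auto simp: Z_def V_def)
    qed
  qed
  then have "card (V - Z) \<le> card S + card B"
    using fin card_mono[of "S \<union> B" "V - Z"] card_Un_le[of S B] by simp
  moreover have "card (V - Z) = card V - card Z" "card Z \<le> card V"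
    using fin by (auto simp: Z_def intro!: card_Diff_subset card_mono)
  ultimately have S: "\<bar>real (card S) - (real (card V) - real (card Z))\<bar> \<le> real (card B)"
    by linarith
  have B: "real (card B) \<le> W * ((real n + 1) / 2 ^ m)"
  proof -
    have "card B \<le> (n + 1) * d ^ (n - (m + 1))"
      unfolding B_def P_def f_def by (rule large_irreducibles_bound[OF DK cardD p])
    then have "real (card B) \<le> real ((n + 1) * d ^ (n - (m + 1)))"
      by (rule of_nat_mono)
    also have "\<dots> = (real n + 1) * real d ^ (n - (m + 1))"
      by (simp add: distrib_right)
    also have "real d ^ (n - (m + 1)) \<le> W / 2 ^ m"
    proof -
      have "m + 1 \<le> n"
        using p CHAR_prime[where ?'a = 'a, THEN prime_ge_1_nat] mult_le_mono1[of 1 "CHAR('a)" m]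
        by linarith
      then have "W = real d ^ (n - (m + 1)) * real d ^ (m + 1)"
        by (simp only: W power_add[symmetric] le_add_diff_inverse2)
      moreover have "2 ^ m \<le> real d ^ (m + 1)"
      proof -
        have "(2 :: real) ^ m \<le> 2 ^ (m + 1)" by simp
        also have "\<dots> \<le> real d ^ (m + 1)"
          using d2 by (intro power_mono) auto
        finally show ?thesis .
      qed
      ultimately have "real d ^ (n - (m + 1)) * 2 ^ m \<le> W"
        by (simp add: mult_left_mono)
      then show ?thesis
        by (simp add: pos_le_divide_eq)
    qed
    finally show ?thesis
      by (simp add: mult_left_mono mult_ac)
  qed
  have "2 / Q ^ m \<le> 2 / 2 ^ m"
    using Q2 by (intro divide_left_mono power_mono) auto
  then have "2 * \<epsilon> \<le> 4 / 2 ^ m + 2 * (Q ^ (2 * m + 1) * \<rho> ^ ((n - 2) div (4 * m)))"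
    unfolding \<epsilon>_def by simp
  then have "W * (2 * \<epsilon>) \<le> W * (4 / 2 ^ m + 2 * (Q ^ (2 * m + 1) * \<rho> ^ ((n - 2) div (4 * m))))"
    using W0 by (rule mult_left_mono)
  then have \<epsilon>: "2 * (W * \<epsilon>) \<le> W * (4 / 2 ^ m + 2 * (Q ^ (2 * m + 1) * \<rho> ^ ((n - 2) div (4 * m))))"
    by (simp only: mult.left_commute)
  have "\<bar>N - (x - y)\<bar> \<le> e' + b'"
    if "\<bar>N - (v - z)\<bar> \<le> b" "\<bar>v - x\<bar> \<le> e" "\<bar>z - y\<bar> \<le> e" "b \<le> b'" "2 * e \<le> e'"
    for N x y e' b' v z b e :: real
    using that by linarith
  from this[OF S V Z B \<epsilon>] have "\<bar>real (card S) - kappa p k s R * W\<bar> \<le>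
      W * (4 / 2 ^ m + 2 * (Q ^ (2 * m + 1) * \<rho> ^ ((n - 2) div (4 * m)))) + W * ((real n + 1) / 2 ^ m)"
    unfolding main .
  also have "\<dots> = W * ((real n + 5) / 2 ^ m + 2 * Q ^ (2 * m + 1) * \<rho> ^ ((n - 2) div (4 * m)))"
    by (simp add: add_divide_distrib algebra_simps)
  finally show "\<bar>real (card (restricted_squarefree K R n)) - kappa p k s R * W\<bar> \<le>
      W * ((real n + 5) / 2 ^ m + 2 * real (card K) ^ (2 * m + 1) * \<rho> ^ ((n - 2) div (4 * m)))"
    unfolding card_S Q_def .
qed

end

text \<open>
  Put \<open>x = n^(1/4)\<close>.  Since \<open>2^q \<ge> q\<close>, the choice of \<open>m\<close> gives \<open>2^(- m) \<le> q^(- 2 x)\<close>, which beats \<open>q^(- x)\<close>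
  by more than the factor \<open>n\<close>.  In the other term \<open>q^(2 m + 1)\<close> is exponential in \<open>x\<close> while the exponent
  of \<open>\<rho>\<close> is of the order of \<open>n / m\<close>, that is \<open>x\<^sup>3\<close>.  The second alternative is for the finitely
  many small \<open>n\<close>, where a large \<open>C\<close> makes the claimed bound trivial.
\<close>
lemma sieve_error_asymptotics:
  fixes q p :: nat and \<rho> :: real
  assumes q: "q \<ge> 2" and \<rho>: "0 < \<rho>" "\<rho> < 1"
  defines "m \<equiv> (\<lambda>n. 2 * q * nat \<lceil>real n powr (1 / 4)\<rceil>)"
  defines "err \<equiv> (\<lambda>n. (real n + 5) / 2 ^ m n + 2 * real q ^ (2 * m n + 1) * \<rho> ^ ((n - 2) div (4 * m n)))"
  shows "\<exists>C>0. \<forall>n. (p * m n + 1 < n \<and> 2 * err n \<le> C * real q powr (- (real n powr (1 / 4)))) \<or>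
                    2 \<le> C * real q powr (- (real n powr (1 / 4)))"
proof -
  define x where "x = (\<lambda>n. real n powr (1 / 4))"
  define a b r where "a = ln (real q)" and "b = - ln \<rho>" and "r = real q"
  \<comment> \<open>A closed form in \<open>x\<close>, free of rounding, that bounds twice the error divided by \<open>q^(- x)\<close>.\<close>
  define F where "F = (\<lambda>x::real. 2 * (x ^ 4 + 5) * exp (- a * x) +
     4 * exp (a * (4 * r * (x + 1) + 1 + x) - b * ((x ^ 4 - 2) / (8 * r * (x + 1)) - 1)))"
  have pos: "a > 0" "b > 0" "r > 0"
    using q \<rho> by (auto simp: a_def b_def r_def ln_gt_zero)
  have lim: "filterlim x at_top at_top"
    unfolding x_def by real_asymp
  have "(F \<longlongrightarrow> 0) at_top"
    unfolding F_def using pos by real_asymp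
  then have "eventually (\<lambda>x. F x < 1) at_top"
    by (rule order_tendstoD) simp
  then have ev1: "eventually (\<lambda>n. F (x n) < 1) at_top"
    using lim by (rule eventually_compose_filterlim)
  have "eventually (\<lambda>x. real p * (2 * r * (x + 1)) + 1 < x ^ 4) at_top"
    using pos by real_asymp
  then have ev2: "eventually (\<lambda>n. real p * (2 * r * (x n + 1)) + 1 < x n ^ 4) at_top"
    using lim by (rule eventually_compose_filterlim)
  have good: "p * m n + 1 < n \<and> 2 * err n * real q powr x n \<le> 1"
    if n: "n \<ge> 2" and F: "F (x n) < 1" and G: "real p * (2 * r * (x n + 1)) + 1 < x n ^ 4" for n
  proof -
    have x4: "x n ^ 4 = real n"
      unfolding x_def using n by (simp add: powr_power)
    have x1: "x n \<ge> 1"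
      unfolding x_def using n by (intro ge_one_powr_ge_zero) auto
    define c where "c = nat \<lceil>x n\<rceil>"
    have c: "x n \<le> real c" "real c \<le> x n + 1" "c \<ge> 1"
      unfolding c_def using x1 by linarith+
    have m: "m n = 2 * q * c"
      by (simp add: m_def c_def x_def)
    have m_ge: "2 * r * x n \<le> real (m n)" and m_le: "real (m n) \<le> 2 * r * (x n + 1)"
      using c pos by (auto simp: m r_def)
    have m_pos: "m n > 0"
      using c q by (simp add: m)
    have "real p * real (m n) + 1 \<le> real p * (2 * r * (x n + 1)) + 1"
      using m_le by (simp add: mult_left_mono)
    then have 1: "p * m n + 1 < n"
      using G x4 by (metis (no_types, lifting) le_less_trans of_nat_1 of_nat_add of_nat_less_iff of_nat_mult)
    have expa: "exp (a * y) = real q powr y" for y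
      using q by (simp add: a_def powr_def mult.commute)
    have t1: "1 / 2 ^ m n \<le> exp (- 2 * a * x n)"
    proof -
      have "real q \<le> 2 ^ q"
        by (metis less_imp_le of_nat_le_iff of_nat_less_two_power of_nat_numeral of_nat_power of_nat_less_iff)
      then have "real q ^ (2 * c) \<le> (2 ^ q) ^ (2 * c)"
        by (rule power_mono) simp
      also have "\<dots> = 2 ^ m n"
        by (simp add: m power_mult[symmetric] mult_ac)
      finally have "real q powr (2 * real c) \<le> 2 ^ m n"
        using q powr_realpow[of "real q" "2 * c"] by simp
      moreover have "real q powr (2 * x n) \<le> real q powr (2 * real c)"
        using c q by (intro powr_mono) auto
      ultimately have le: "exp (2 * a * x n) \<le> 2 ^ m n"
        using expa[of "2 * x n"] by (simp add: mult_ac)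
      have "1 / 2 ^ m n \<le> 1 / exp (2 * a * x n)"
        using le by (intro divide_left_mono) auto
      then show ?thesis
        by (simp add: exp_minus field_simps)
    qed
    have t2: "real q ^ (2 * m n + 1) \<le> exp (a * (4 * r * (x n + 1) + 1))"
    proof -
      have "real q ^ (2 * m n + 1) = real q powr (2 * real (m n) + 1)"
        using q powr_realpow[of "real q" "2 * m n + 1"] by (simp add: add.commute)
      also have "\<dots> \<le> real q powr (4 * r * (x n + 1) + 1)"
        using q m_le by (intro powr_mono) auto
      finally show ?thesis
        using expa by simp
    qed
    have t3: "\<rho> ^ ((n - 2) div (4 * m n)) \<le> exp (- b * ((x n ^ 4 - 2) / (8 * r * (x n + 1)) - 1))"
    proof -
      define e where "e = (n - 2) div (4 * m n)"
      have "n - 2 < (e + 1) * (4 * m n)"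
        unfolding e_def using m_pos by (simp add: dividend_less_div_times)
      then have "real (n - 2) < real ((e + 1) * (4 * m n))"
        by (simp only: of_nat_less_iff)
      then have "x n ^ 4 - 2 < (real e + 1) * (4 * real (m n))"
        using n x4 by (simp add: of_nat_diff distrib_right)
      also have "\<dots> \<le> (real e + 1) * (8 * r * (x n + 1))"
        using m_le by (intro mult_left_mono) auto
      finally have "(x n ^ 4 - 2) / (8 * r * (x n + 1)) - 1 \<le> real e"
      proof -
        assume less: "x n ^ 4 - 2 < (real e + 1) * (8 * r * (x n + 1))"
        have "8 * r * (x n + 1) > 0"
          using pos x1 by simp
        from less[folded pos_divide_less_eq[OF this]] show ?thesis
          by simp
      qed
      then have "exp (- b * real e) \<le> exp (- b * ((x n ^ 4 - 2) / (8 * r * (x n + 1)) - 1))"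
        using pos by simp
      moreover have "\<rho> ^ e = exp (- b * real e)"
        using \<rho> by (simp add: b_def exp_of_nat2_mult)
      ultimately show ?thesis
        by (simp add: e_def)
    qed
    have "2 * err n * real q powr x n =
        2 * (real n + 5) * (1 / 2 ^ m n) * exp (a * x n) +
        4 * (real q ^ (2 * m n + 1) * \<rho> ^ ((n - 2) div (4 * m n))) * exp (a * x n)"
      by (simp add: err_def expa algebra_simps add_divide_distrib)
    also have "\<dots> \<le> 2 * (real n + 5) * exp (- 2 * a * x n) * exp (a * x n) +
        4 * (exp (a * (4 * r * (x n + 1) + 1)) *
          exp (- b * ((x n ^ 4 - 2) / (8 * r * (x n + 1)) - 1))) * exp (a * x n)"
      using \<rho> by (intro add_mono mult_right_mono mult_left_mono mult_mono t1 t2 t3) auto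
    also have "\<dots> = F (x n)"
      unfolding F_def x4 by (simp add: mult.assoc flip: exp_add) (simp add: algebra_simps)
    finally show ?thesis
      using 1 F by simp
  qed
  have "eventually (\<lambda>n. p * m n + 1 < n \<and> 2 * err n * real q powr x n \<le> 1) at_top"
    using ev1 ev2 eventually_ge_at_top[of 2] by eventually_elim (rule good)
  then obtain N where N: "\<And>n. n \<ge> N \<Longrightarrow> p * m n + 1 < n \<and> 2 * err n * real q powr x n \<le> 1"
    by (auto simp: eventually_at_top_linorder)
  define C where "C = 1 + (\<Sum>n<N. 2 * real q powr x n)"
  have C1: "C \<ge> 1"
    unfolding C_def by (simp add: sum_nonneg)
  have qx: "real q powr x n > 0" for n
    using q by simp
  have "(p * m n + 1 < n \<and> 2 * err n \<le> C * real q powr (- x n)) \<or> 2 \<le> C * real q powr (- x n)" for n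
  proof (cases "n < N")
    case True
    then have "2 * real q powr x n \<le> (\<Sum>n<N. 2 * real q powr x n)"
      by (intro member_le_sum) auto
    then have "2 * real q powr x n \<le> C"
      by (simp add: C_def)
    then show ?thesis
      using qx[of n] by (simp add: powr_minus field_simps)
  next
    case False
    then have *: "p * m n + 1 < n" "2 * err n * real q powr x n \<le> 1"
      using N[of n] by auto
    then have "2 * err n * real q powr x n \<le> C"
      using C1 by linarith
    then show ?thesis
      using * qx[of n] by (simp add: powr_minus field_simps)
  qed
  then show ?thesis
    using C1 unfolding x_def by (intro exI[of _ C]) auto
qed

theorem corollary1p4:
  fixes p :: nat
  assumes "CHAR('a :: finite_field) = p"
  shows "\<exists>C>0. \<forall>(k::nat) (K :: 'a set) (n::nat) (s::nat) (R :: nat \<Rightarrow> 'a set).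
           is_subfield K \<and> card K = p ^ k \<and> n \<ge> 2 \<and>
           (\<forall>i<n. R i \<subseteq> K \<and> card (R i) = s \<and>
                  \<not> (\<exists>A. proper_affine_subspace_of K A \<and> K - R i \<subseteq> A))
           \<longrightarrow> (\<exists>E::real.
                 real (card (restricted_squarefree K R n)) =
                   kappa p k s R * (real p ^ k - real s) ^ n * (1 + E) \<and>
                 \<bar>E\<bar> \<le> C * real p powr (- (real k * real n powr (1 / 4))))"
proof -
  obtain \<psi> :: "'a \<Rightarrow> complex" where "\<And>x y. \<psi> (x + y) = \<psi> x * \<psi> y" "\<And>x. cmod (\<psi> x) = 1" "\<psi> 1 \<noteq> 1"
    using ex_additive_character by blast
  then interpret additive_character \<psi>
    by unfold_locales
  obtain \<rho> where \<rho>: "0 < \<rho>" "\<rho> < 1"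
    and decay: "\<And>D c. cmod (\<Sum>a\<in>D. \<psi> (a * c)) < real (card D) \<Longrightarrow>
                  cmod (\<Sum>a\<in>D. \<psi> (a * c)) \<le> \<rho> * real (card D)"
    using ex_uniform_decay by blast
  define q where "q = card (UNIV :: 'a set)"
  have "card {0, 1 :: 'a} \<le> q"
    unfolding q_def by (intro card_mono) auto
  then have q: "q \<ge> 2" by simp
  define m where "m = (\<lambda>n. 2 * q * nat \<lceil>real n powr (1 / 4)\<rceil>)"
  define err where "err = (\<lambda>n. (real n + 5) / 2 ^ m n + 2 * real q ^ (2 * m n + 1) * \<rho> ^ ((n - 2) div (4 * m n)))"
  obtain C where C: "C > 0" "\<And>n. (p * m n + 1 < n \<and> 2 * err n \<le> C * real q powr (- (real n powr (1 / 4)))) \<or>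
                    2 \<le> C * real q powr (- (real n powr (1 / 4)))"
    using sieve_error_asymptotics[OF q \<rho>, of p] unfolding err_def m_def by blast
  show ?thesis
  proof (rule exI[of _ C], intro conjI allI impI C(1))
    fix k :: nat and K :: "'a set" and n s :: nat and R :: "nat \<Rightarrow> 'a set"
    assume H: "is_subfield K \<and> card K = p ^ k \<and> n \<ge> 2 \<and>
           (\<forall>i<n. R i \<subseteq> K \<and> card (R i) = s \<and>
                  \<not> (\<exists>A. proper_affine_subspace_of K A \<and> K - R i \<subseteq> A))"
    then interpret subfield_character K \<psi>
      by unfold_locales blast
    define W where "W = (real p ^ k - real s) ^ n"
    define S where "S = real (card (restricted_squarefree K R n))"
    define \<kappa> where "\<kappa> = kappa p k s R"
    have d: "real p ^ k - real s \<ge> 2" and S_le: "S \<le> W" and \<kappa>: "\<kappa> \<ge> 1 / 2"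
      and S: "m n \<ge> 1 \<Longrightarrow> p * m n + 1 < n \<Longrightarrow> \<bar>S - \<kappa> * W\<bar> \<le>
             W * ((real n + 5) / 2 ^ m n + 2 * real (card K) ^ (2 * m n + 1) * \<rho> ^ ((n - 2) div (4 * m n)))"
      using restricted_squarefree_asymptotics[where n = n and R = R and s = s and \<rho> = \<rho> and p = p and k = k, OF _ _ _ \<rho> decay] H
      unfolding W_def S_def \<kappa>_def assms by blast+
    have W: "W > 0"
      unfolding W_def using d by (intro zero_less_power) linarith
    have \<kappa>W: "\<kappa> * W \<ge> W / 2" "\<kappa> * W > 0"
      using mult_right_mono[OF \<kappa>, of W] W by auto
    have Kq: "real (card K) \<le> real q"
      unfolding q_def by (simp add: card_mono)
    \<comment> \<open>The error was estimated in terms of \<open>q\<close>, which suffices as \<open>p^k = card K \<le> q\<close>.\<close>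
    have rate: "C * real q powr (- (real n powr (1 / 4))) \<le> C * real p powr (- (real k * real n powr (1 / 4)))"
    proof -
      have "real p > 0"
        using assms CHAR_prime[where ?'a = 'a] prime_gt_0_nat by simp
      then have "real p powr (- (real k * real n powr (1 / 4))) = real (card K) powr (- (real n powr (1 / 4)))"
        using H by (simp add: powr_powr flip: powr_realpow)
      also have "\<dots> \<ge> real q powr (- (real n powr (1 / 4)))"
        using Kq card_K_ge_2 by (intro powr_mono2') auto
      finally show ?thesis
        using C(1) by simp
    qed
    have E: "\<bar>S / (\<kappa> * W) - 1\<bar> \<le> C * real q powr (- (real n powr (1 / 4)))"
      using C(2)[of n]
    proof
      assume *: "p * m n + 1 < n \<and> 2 * err n \<le> C * real q powr (- (real n powr (1 / 4)))"
      have "real n powr (1 / 4) > 0"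
        using H by simp
      then have "nat \<lceil>real n powr (1 / 4)\<rceil> > 0"
        by linarith
      then have "m n > 0"
        using q unfolding m_def by (intro mult_pos_pos) auto
      then have "m n \<ge> 1"
        by linarith
      then have "\<bar>S - \<kappa> * W\<bar> \<le>
             W * ((real n + 5) / 2 ^ m n + 2 * real (card K) ^ (2 * m n + 1) * \<rho> ^ ((n - 2) div (4 * m n)))"
        using S * by blast
      also have "\<dots> \<le> W * err n"
        unfolding err_def using W Kq \<rho>
        by (intro mult_left_mono add_left_mono mult_right_mono power_mono) auto
      finally have "\<bar>S - \<kappa> * W\<bar> \<le> W * err n" .
      moreover have "\<bar>S / (\<kappa> * W) - 1\<bar> = \<bar>S - \<kappa> * W\<bar> / (\<kappa> * W)"
      proof -
        have "S / (\<kappa> * W) - 1 = (S - \<kappa> * W) / (\<kappa> * W)"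
          unfolding diff_divide_distrib using \<kappa> W by simp
        then show ?thesis
          by (simp only: abs_divide abs_of_pos[OF \<kappa>W(2)])
      qed
      moreover have "err n \<ge> 0"
        using \<rho> by (simp add: err_def)
      ultimately have "\<bar>S / (\<kappa> * W) - 1\<bar> \<le> (W * err n) / (W / 2)"
        using \<kappa>W(1) W frac_le[of "W * err n" "\<bar>S - \<kappa> * W\<bar>" "W / 2" "\<kappa> * W"] by simp
      also have "\<dots> = 2 * err n"
        using W by simp
      finally show ?thesis
        using * by linarith
    next
      assume *: "2 \<le> C * real q powr (- (real n powr (1 / 4)))"
      have "S / (\<kappa> * W) \<le> W / (W / 2)"
        using S_le \<kappa>W W by (intro frac_le) auto
      then have "S / (\<kappa> * W) \<le> 2"
        using W by simp
      moreover have "S / (\<kappa> * W) \<ge> 0"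
        using \<kappa>W by (simp add: S_def)
      ultimately show ?thesis
        using * by linarith
    qed
    show "\<exists>E. real (card (restricted_squarefree K R n)) =
                kappa p k s R * (real p ^ k - real s) ^ n * (1 + E) \<and>
              \<bar>E\<bar> \<le> C * real p powr (- (real k * real n powr (1 / 4)))"
    proof (rule exI[of _ "S / (\<kappa> * W) - 1"], rule conjI)
      show "real (card (restricted_squarefree K R n)) =
              kappa p k s R * (real p ^ k - real s) ^ n * (1 + (S / (\<kappa> * W) - 1))"
        using \<kappa> W unfolding S_def[symmetric] W_def[symmetric] \<kappa>_def[symmetric] by simp
      show "\<bar>S / (\<kappa> * W) - 1\<bar> \<le> C * real p powr (- (real k * real n powr (1 / 4)))"
        using E rate by linarith
    qed
  qed
qed

end
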